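(* Let $(X,d)$ be a metric space and $K:X\to[0,+\infty)$ a function such that: (i) $(X,d)$ is a proper length metric space; (ii) $K$ is continuous and $\Sigma:=\{x\in X:K(x)=0\}$ is finite (and non-empty); (iii) there is a function $k\in C^0([0,+\infty),[0,+\infty))$ with $\int_0^\infty k(t)\,dt=+\infty$ such that $K(x)\ge k(d(x,\Sigma))$ for all $x\in X$. Then for any $x,y\in X$ there exist an interval $I$ and a curve $\gamma\in\mathcal{L}_{ploc}(I,X)$ such that $\gamma:x\mapsto y$ and $L_K(\gamma)=d_K(x,y)$.
   Context: Curves. A curve in a metric space $(X,d)$ is a continuous map $\gamma:I\to X$, with $I\subset\mathbb{R}$ a non-empty interval. $\mathcal{L}_{loc}(I,X)$ denotes the set of locally Lipschitz maps $I\to X$ (with respect to $d$). The set of piecewise locally Lipschitz maps is $$\mathcal{L}_{ploc}(I,X):=\{\gamma\in C(I,X):\exists\, t_0=\inf I<t_1<\dots<t_n=\sup I,\ \forall i,\ \gamma|_{I\cap(t_i,t_{i+1})}\in\mathcal{L}_{loc}(I\cap(t_i,t_{i+1}),X)\}$$ (where $t_0$, $t_n$ may be infinite). Metric derivative. For $\gamma\in\mathcal{L}_{ploc}(I,X)$, the metric derivative $|\dot\gamma|(t)=\lim_{s\to t}\frac{d(\gamma(t),\gamma(s))}{|t-s|}$ exists for a.e. $t\in I$ and is measurable. Paths. $\gamma:x^-\mapsto x^+$ means that $\gamma$ is a path from $x^-$ to $x^+$: there are $a^-\le a^+$ with $\gamma\in C^0([a^-,a^+],X)$ and $\gamma(a^\pm)=x^\pm$;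 infinite $a^\pm$ are allowed, with the convention $\gamma(\pm\infty):=\lim_{t\to\pm\infty}\gamma(t)$, the limit being required to exist. Length spaces and proper spaces. The length of a curve is $L_d(\gamma):=\sup\sum_{i=0}^{N-1}d(\gamma(t_i),\gamma(t_{i+1}))$, the supremum being over all $N\ge1$ and $t_0\le\dots\le t_N$ in $I$. $(X,d)$ is a length space if $d(x,y)=\inf\{L_d(\gamma):\gamma:x\mapsto y\}$ for all $x,y\in X$. A metric space is proper if every bounded closed subset is compact. $d(x,\Sigma):=\inf_{z\in\Sigma}d(x,z)$. Weighted length. For $\gamma\in\mathcal{L}_{ploc}(I,X)$, $L_K(\gamma):=\int_I K(\gamma(t))\,|\dot\gamma|(t)\,dt$, and for $x,y\in X$, $$d_K(x,y):=\inf\{L_K(\gamma)\;:\;\gamma\in\mathcal{L}_{ploc}(I,X),\ \gamma:x\mapsto y\}$$ (the infimum is over all intervals $I$ and all such curves). *)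

theory Defs
  imports "HOL-Analysis.Analysis"
begin

text \<open>
  A curve \<open>\<gamma> : I \<rightarrow> X\<close> is a total function \<open>\<gamma> :: real \<Rightarrow> 'a\<close> together with its parameter
  interval \<open>I\<close>. All notions below depend only on the restriction of \<open>\<gamma>\<close> to \<open>I\<close>. Lengths are valued
  in \<^typ>\<open>ennreal\<close>, since piecewise locally Lipschitz curves may have infinite length.
\<close>

definition locally_lipschitz_curve :: "(real \<Rightarrow> 'a::metric_space) \<Rightarrow> real set \<Rightarrow> bool" where
  "locally_lipschitz_curve \<gamma> I \<longleftrightarrow>
     (\<forall>t\<in>I. \<exists>u>0. \<exists>L. L-lipschitz_on (cball t u \<inter> I) \<gamma>)"

text \<open>
  The subdivision lives in the extended reals, so its end points may be infinite. The case \<open>n = 0\<close>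
  occurs only for one-point intervals (\<open>I\<close> being non-empty).
\<close>

definition piecewise_loc_lipschitz :: "(real \<Rightarrow> 'a::metric_space) \<Rightarrow> real set \<Rightarrow> bool" where
  "piecewise_loc_lipschitz \<gamma> I \<longleftrightarrow>
     is_interval I \<and> I \<noteq> {} \<and> continuous_on I \<gamma> \<and>
     (\<exists>(n::nat) (t::nat \<Rightarrow> ereal).
        t 0 = (INF s\<in>I. ereal s) \<and> t n = (SUP s\<in>I. ereal s) \<and> (\<forall>i<n. t i < t (Suc i)) \<and>
        (\<forall>i<n. locally_lipschitz_curve \<gamma> {s\<in>I. t i < ereal s \<and> ereal s < t (Suc i)}))"

definition curve_end :: "(real \<Rightarrow> 'a::metric_space) \<Rightarrow> ereal \<Rightarrow> 'a \<Rightarrow> bool" where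
  "curve_end \<gamma> a x \<longleftrightarrow>
     (case a of ereal r \<Rightarrow> \<gamma> r = x
      | PInfty \<Rightarrow> (\<gamma> \<longlongrightarrow> x) at_top
      | MInfty \<Rightarrow> (\<gamma> \<longlongrightarrow> x) at_bot)"

text \<open>
  The parameter interval of a curve from \<open>x\<close> to \<open>y\<close> is the set of real points of an extended-real
  interval \<open>[a, b]\<close>. Requiring \<open>I \<noteq> {}\<close> discards just \<open>a = b = \<plusminus>\<infinity>\<close>.
\<close>

definition curve_from_to :: "(real \<Rightarrow> 'a::metric_space) \<Rightarrow> real set \<Rightarrow> 'a \<Rightarrow> 'a \<Rightarrow> bool" where
  "curve_from_to \<gamma> I x y \<longleftrightarrow>
     (\<exists>a b::ereal. a \<le> b \<and> I = {t. a \<le> ereal t \<and> ereal t \<le> b} \<and> I \<noteq> {} \<and>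
        continuous_on I \<gamma> \<and> curve_end \<gamma> a x \<and> curve_end \<gamma> b y)"

definition curve_length :: "(real \<Rightarrow> 'a::metric_space) \<Rightarrow> real set \<Rightarrow> ennreal" where
  "curve_length \<gamma> I =
     (SUP (N, t) \<in> {(N::nat, t::nat \<Rightarrow> real).
                      1 \<le> N \<and> (\<forall>i\<le>N. t i \<in> I) \<and> (\<forall>i<N. t i \<le> t (Suc i))}.
        \<Sum>i<N. ennreal (dist (\<gamma> (t i)) (\<gamma> (t (Suc i)))))"

definition length_space :: "'a::metric_space itself \<Rightarrow> bool" where
  "length_space _ \<longleftrightarrow>
     (\<forall>x y::'a. ennreal (dist x y) =
        (INF (\<gamma>, I) \<in> {(\<gamma>, I). curve_from_to \<gamma> I x y}. curve_length \<gamma> I))"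

definition proper_space :: "'a::metric_space itself \<Rightarrow> bool" where
  "proper_space _ \<longleftrightarrow> (\<forall>S::'a set. bounded S \<and> closed S \<longrightarrow> compact S)"

text \<open>
  \<^const>\<open>Lim\<close> is unspecified where the limit does not exist. For piecewise locally Lipschitz curves this
  concerns only a null set of parameters, which does not affect the integral below.
\<close>

definition metric_derivative :: "(real \<Rightarrow> 'a::metric_space) \<Rightarrow> real set \<Rightarrow> real \<Rightarrow> real" where
  "metric_derivative \<gamma> I t = Lim (at t within I) (\<lambda>s. dist (\<gamma> t) (\<gamma> s) / \<bar>t - s\<bar>)"

definition weighted_length ::
  "('a::metric_space \<Rightarrow> real) \<Rightarrow> (real \<Rightarrow> 'a) \<Rightarrow> real set \<Rightarrow> ennreal" where
  "weighted_length K \<gamma> I = (\<integral>\<^sup>+t\<in>I. ennreal (K (\<gamma> t) * metric_derivative \<gamma> I t) \<partial>lborel)"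

definition weighted_dist :: "('a::metric_space \<Rightarrow> real) \<Rightarrow> 'a \<Rightarrow> 'a \<Rightarrow> ennreal" where
  "weighted_dist K x y =
     (INF (\<gamma>, I) \<in> {(\<gamma>, I). piecewise_loc_lipschitz \<gamma> I \<and> curve_from_to \<gamma> I x y}.
        weighted_length K \<gamma> I)"

end

theory Submission
  imports Defs
begin

text \<open>
  The weighted distance is compared with a discrete quantity. A \<^emph>\<open>chain\<close> is a finite sequence of points
  \<open>x\<^sub>0, \<dots>, x\<^sub>n\<close> with steps of size at most \<open>\<epsilon>\<close>, and its cost is the Riemann sum of
  \<open>K x\<^sub>i * dist x\<^sub>i x\<^sub>i\<^sub>+\<^sub>1\<close>. The relation \<open>reach K x y c\<close> says that for every \<open>\<epsilon>\<close> some chain with steps at most \<open>\<epsilon>\<close>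
  leads from \<open>x\<close> to \<open>y\<close> at cost at most \<open>c + \<epsilon>\<close>. It is stable under concatenation and under limits, so there is
  a least \<open>l\<close> with \<open>reach K x y l\<close>. The theorem follows from two facts, which together say that \<open>l\<close> is the weighted
  distance and is attained.

  First, an admissible curve of weighted length \<open>w\<close> gives \<open>reach K x y w\<close> (\<open>weighted_length_imp_reach\<close>).
  Sampling the curve finely produces the chains, provided that the distance of two points of
  the curve is at most the integral of the metric derivative in between. Together with the almost everywhere
  existence of the metric derivative, this is \<open>lipschitz_metric_derivative\<close>. Its proof tests the curve with the
  distances to countably many of its points. It therefore needs the one-dimensional theory of real Lipschitz
  functions: they are differentiable almost everywhere and dominated by the integral of the derivative. The
  density comes from the Radon-Nikodym theorem, the pointwise statement from a Vitali covering argument.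

  Second, the least \<open>l\<close> belongs to a curve of weighted length at most \<open>l\<close> (\<open>minimal_reach_curve\<close>). Parametrise
  nearly optimal chains by their accumulated cost. By the divergence of \<open>\<integral> k\<close> these step functions take values
  in a compact set, because a chain that goes far away from the zeros of \<open>K\<close> has to pay the integral of \<open>k\<close>. By
  Tychonoff's theorem they have a pointwise cluster point \<open>\<gamma>\<close>, which satisfies \<open>reach K (\<gamma> s) (\<gamma> s') (s' - s)\<close> for
  \<open>s \<le> s'\<close>: it is 1-Lipschitz with respect to the discrete distance. Where \<open>K > 0\<close>, the discrete distance is locally
  at least \<open>\<kappa> * dist\<close> for every \<open>\<kappa> < K\<close>, so \<open>\<gamma>\<close> is locally Lipschitz there, its metric derivative times \<open>K\<close> is at
  most 1, and its weighted length is at most \<open>l\<close>. As the zeros of \<open>K\<close> are finite in number, the discrete distance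
  separates points even there, which makes \<open>\<gamma>\<close> continuous. Finally \<open>\<gamma>\<close> visits no point twice, since
  a loop could be cut out of a curve of minimal cost. Hence it meets the zeros of \<open>K\<close> at finitely many
  parameters, and it is piecewise locally Lipschitz.

  The length space property enters only through midpoints: they yield chains of bounded cost between any two
  points, so that \<open>l\<close> exists.
\<close>

section \<open>Lebesgue differentiation on the line\<close>

text \<open>
  The Vitali covering theorem for balls, restated for closed intervals: an interval is the ball around its
  midpoint.
\<close>

lemma Vitali_covering_intervals:
  fixes K :: "(real \<times> real) set"
  assumes K: "\<And>i. i \<in> K \<Longrightarrow> fst i < snd i"
    and S: "\<And>x d. x \<in> S \<Longrightarrow> 0 < d \<Longrightarrow> \<exists>i\<in>K. x \<in> {fst i..snd i} \<and> snd i - fst i < d"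
  obtains C where "countable C" "C \<subseteq> K" "disjoint_family_on (\<lambda>i. {fst i..snd i}) C"
    "negligible (S - (\<Union>i\<in>C. {fst i..snd i}))"
proof -
  define a r where "a i = (fst i + snd i) / 2" and "r i = (snd i - fst i) / 2" for i :: "real \<times> real"
  have ball: "cball (a i) (r i) = {fst i..snd i}" for i
    by (auto simp: cball_eq_atLeastAtMost a_def r_def field_simps)
  have r: "0 < r i" if "i \<in> K" for i
    using K[OF that] by (simp add: r_def)
  have fine: "\<exists>i. i \<in> K \<and> x \<in> cball (a i) (r i) \<and> r i < d" if xd: "x \<in> S" "0 < d" for x d
  proof -
    obtain i where "i \<in> K" "x \<in> {fst i..snd i}" "snd i - fst i < d" using S[OF xd] by blast
    then show ?thesis using r[of i] unfolding ball by (intro exI[of _ i]) (auto simp: r_def)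
  qed
  show thesis
  proof (rule Vitali_covering_theorem_cballs[where K = K and S = S and a = a and r = r])
    show "0 < r i" if "i \<in> K" for i using r that .
    show "\<exists>i. i \<in> K \<and> x \<in> cball (a i) (r i) \<and> r i < d" if "x \<in> S" "0 < d" for x d
      using fine that .
    fix C assume "countable C" "C \<subseteq> K"
     "pairwise (\<lambda>i j. disjnt (cball (a i) (r i)) (cball (a j) (r j))) C"
     "negligible (S - (\<Union>i\<in>C. cball (a i) (r i)))"
    then show thesis
      by (intro that[of C]) (auto simp: ball pairwise_def disjoint_family_on_def disjnt_def)
  qed
qed

text \<open>
  Let \<open>E\<close> be the set of points where \<open>f < q\<close> although averages of \<open>f\<close> over arbitrarily small intervals exceed
  \<open>r > q\<close>. Cover \<open>E\<close> by disjoint such intervals inside an open set \<open>U\<close> that is only slightly larger than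
  \<open>A = {f < q}\<close>. On their union \<open>V\<close> the integral of \<open>f\<close> is at least \<open>r\<close> times the measure of \<open>V\<close>, but at most \<open>q\<close> times it,
  plus the small contribution of \<open>U - A\<close>. So \<open>V\<close> has small measure.
\<close>

lemma negligible_excess_average:
  fixes f :: "real \<Rightarrow> real"
  assumes [measurable]: "f \<in> borel_measurable borel"
    and f: "\<And>t. 0 \<le> f t" "\<And>t. f t \<le> M" and qr: "0 \<le> q" "q < r"
  shows "negligible {t. f t < q \<and> (\<forall>d>0. \<exists>u v. u \<le> t \<and> t \<le> v \<and> u < v \<and> v - u < d \<and>
           ennreal (r * (v - u)) < (\<integral>\<^sup>+x\<in>{u..v}. ennreal (f x) \<partial>lborel))}"
    (is "negligible ?E")
proof (subst negligible_on_intervals, intro allI)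
  fix a b :: real
  define B where "B = {a-1<..<b+1}"
  define A where "A = {t \<in> {a..b}. f t < q}"
  have M0: "0 \<le> M" using f[of 0] by linarith
  have A_b: "A \<in> sets borel" unfolding A_def by measurable
  define S where "S = ?E \<inter> cbox a b"
  show "negligible (?E \<inter> cbox a b)"
    unfolding S_def[symmetric] negligible_outer_le
  proof (intro allI impI)
    fix e :: real assume "e > 0"
    \<comment> \<open>chosen such that \<open>M * \<eta> \<le> (r - q) * e\<close>\<close>
    define \<eta> where "\<eta> = e * (r - q) / (M + 1)"
    have "\<eta> > 0" using \<open>e > 0\<close> qr M0 by (simp add: \<eta>_def)
    have "A \<in> sets lebesgue" using A_b by auto
    then obtain U where U: "open U" "A \<subseteq> U" "U - A \<in> lmeasurable" "emeasure lebesgue (U - A) < ennreal \<eta>"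
      using sets_lebesgue_outer_open[OF _ \<open>\<eta> > 0\<close>] by metis
    define K where "K = {(u,v). u < v \<and> {u..v} \<subseteq> U \<inter> B \<and>
           ennreal (r * (v - u)) < (\<integral>\<^sup>+x\<in>{u..v}. ennreal (f x) \<partial>lborel)}"
    have fine: "\<exists>i\<in>K. x \<in> {fst i..snd i} \<and> snd i - fst i < d"
      if x: "x \<in> S" and "d > 0" for x d
    proof -
      have "x \<in> U \<inter> B" using x U unfolding S_def A_def B_def by auto
      moreover have "open (U \<inter> B)" using U unfolding B_def by auto
      ultimately obtain d' where d': "d' > 0" "cball x d' \<subseteq> U \<inter> B"
        using open_contains_cball by meson
      have "min d d' > 0" using d' \<open>d > 0\<close> by auto
      then obtain u v where uv: "u \<le> x" "x \<le> v" "u < v" "v - u < min d d'"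
          "ennreal (r * (v - u)) < (\<integral>\<^sup>+x\<in>{u..v}. ennreal (f x) \<partial>lborel)"
        using x unfolding S_def by blast
      have "{u..v} \<subseteq> cball x d'" using uv by (auto simp: cball_eq_atLeastAtMost)
      then have "(u,v) \<in> K" using uv d' unfolding K_def by auto
      then show ?thesis using uv by (intro bexI[of _ "(u,v)"]) auto
    qed
    have pos: "fst i < snd i" and KU: "{fst i..snd i} \<subseteq> U \<inter> B"
      and Kr: "ennreal (r * (snd i - fst i)) < (\<integral>\<^sup>+x\<in>{fst i..snd i}. ennreal (f x) \<partial>lborel)"
      if "i \<in> K" for i
      using that unfolding K_def by (cases i; simp)+
    obtain C where C: "countable C" "C \<subseteq> K"
      and disj: "disjoint_family_on (\<lambda>i. {fst i..snd i}) C"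
      and neg: "negligible (S - (\<Union>i\<in>C. {fst i..snd i}))"
      proof (rule Vitali_covering_intervals[of K S])
      show "fst i < snd i" if "i \<in> K" for i using pos that .
      show "\<exists>i\<in>K. x \<in> {fst i..snd i} \<and> snd i - fst i < d" if "x \<in> S" "0 < d" for x d
        using fine that .
    qed (rule that)
    \<comment> \<open>\<open>\<integral> f\<close> over \<open>V\<close> is squeezed between \<open>r\<close> and \<open>q\<close> times the measure, up to \<open>M * \<eta>\<close>\<close>
    define V where "V = (\<Union>i\<in>C. {fst i..snd i})"
    have V_b[measurable]: "V \<in> sets borel" unfolding V_def using C by (intro sets.countable_UN'') auto
    have VU: "V \<subseteq> U \<inter> B" using KU C unfolding V_def by blast
    have "emeasure lborel V \<le> emeasure lborel B"
      using VU by (intro emeasure_mono) (auto simp: B_def)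
    also have "\<dots> < \<infinity>" unfolding B_def by (intro emeasure_bounded_finite) auto
    finally have V_fin: "emeasure lborel V = ennreal (measure lborel V)"
      by (simp add: emeasure_eq_ennreal_measure less_top)
    let ?\<nu> = "density lborel (\<lambda>x. ennreal (f x))"
    have [measurable]: "A \<in> sets borel" "U \<in> sets borel" using A_b U by auto
    have "ennreal r * emeasure lborel V = (\<integral>\<^sup>+i. ennreal r * emeasure lborel {fst i..snd i} \<partial>count_space C)"
      unfolding V_def using C disj
      by (subst emeasure_UN_countable) (auto simp: nn_integral_cmult)
    also have "\<dots> \<le> (\<integral>\<^sup>+i. emeasure ?\<nu> {fst i..snd i} \<partial>count_space C)"
    proof (intro nn_integral_mono)
      fix i assume "i \<in> space (count_space C)"
      then have "fst i < snd i" "ennreal (r * (snd i - fst i)) < (\<integral>\<^sup>+x\<in>{fst i..snd i}. ennreal (f x) \<partial>lborel)"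
        using C pos Kr by auto
      then show "ennreal r * emeasure lborel {fst i..snd i} \<le> emeasure ?\<nu> {fst i..snd i}"
        using qr by (simp add: emeasure_density ennreal_mult'')
    qed
    also have "\<dots> = emeasure ?\<nu> V"
      unfolding V_def using C disj by (subst emeasure_UN_countable) auto
    also have "\<dots> \<le> emeasure ?\<nu> ((V \<inter> A) \<union> (U - A))"
      using VU by (intro emeasure_mono) auto
    also have "\<dots> \<le> emeasure ?\<nu> (V \<inter> A) + emeasure ?\<nu> (U - A)"
      by (intro emeasure_subadditive) auto
    also have "emeasure ?\<nu> (V \<inter> A) \<le> (\<integral>\<^sup>+x. ennreal q * indicator (V \<inter> A) x \<partial>lborel)"
      by (subst emeasure_density)
         (auto intro!: nn_integral_mono ennreal_leI simp: A_def split: split_indicator)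
    also have "\<dots> = ennreal q * emeasure lborel (V \<inter> A)"
      by (simp add: nn_integral_cmult_indicator)
    also have "\<dots> \<le> ennreal q * emeasure lborel V"
      by (intro mult_left_mono emeasure_mono) auto
    also have "emeasure ?\<nu> (U - A) \<le> (\<integral>\<^sup>+x. ennreal M * indicator (U - A) x \<partial>lborel)"
      by (subst emeasure_density)
         (auto intro!: nn_integral_mono ennreal_leI f split: split_indicator)
    also have "\<dots> = ennreal M * emeasure lborel (U - A)"
      by (simp add: nn_integral_cmult_indicator)
    also have "\<dots> \<le> ennreal M * ennreal \<eta>"
      using U(4) by (intro mult_left_mono) auto
    finally have "ennreal (r * measure lborel V) \<le> ennreal (q * measure lborel V + M * \<eta>)"
      using qr M0 \<open>\<eta> > 0\<close> unfolding V_fin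
      by (simp add: ennreal_mult)
    then have "r * measure lborel V \<le> q * measure lborel V + M * \<eta>"
      using qr M0 \<open>\<eta> > 0\<close> by (subst (asm) ennreal_le_iff) auto
    then have "(r - q) * measure lborel V \<le> M * \<eta>" by (simp add: algebra_simps)
    also have "\<dots> \<le> (r - q) * e"
      using M0 qr \<open>e > 0\<close> unfolding \<eta>_def by (simp add: field_simps)
    finally have Ve: "measure lborel V \<le> e" using qr by simp
    define T where "T = V \<union> (S - V)"
    have neg': "negligible (S - V)" using neg unfolding V_def .
    have Vl: "V \<in> lmeasurable"
      by (intro fmeasurableI) (auto simp: V_fin)
    have "T \<in> lmeasurable"
      unfolding T_def by (intro fmeasurable.Un Vl negligible_imp_measurable neg')
    moreover have "measure lebesgue T = measure lebesgue V"
      unfolding T_def using Vl neg' by (intro measure_Un_null_set) (auto simp: negligible_iff_null_sets fmeasurableD)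
    ultimately show "\<exists>T. S \<subseteq> T \<and> T \<in> lmeasurable \<and> measure lebesgue T \<le> e"
      using Ve by (intro exI[of _ T]) (auto simp: T_def)
  qed
qed

text \<open>
  The upper half of the Lebesgue differentiation theorem. The lower half for \<open>f\<close> is the upper half for a constant
  minus \<open>f\<close>, so that one half suffices for what follows.
\<close>

lemma AE_average_upper:
  fixes f :: "real \<Rightarrow> real"
  assumes "f \<in> borel_measurable borel" and "\<And>t. 0 \<le> f t" "\<And>t. f t \<le> M"
  shows "AE t in lborel. \<forall>r>f t. \<exists>d>0. \<forall>u v. u \<le> t \<and> t \<le> v \<and> u < v \<and> v - u < d \<longrightarrow>
           (\<integral>\<^sup>+x\<in>{u..v}. ennreal (f x) \<partial>lborel) \<le> ennreal (r * (v - u))"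
proof -
  define E where "E q r = {t. f t < q \<and> (\<forall>d>0. \<exists>u v. u \<le> t \<and> t \<le> v \<and> u < v \<and> v - u < d \<and>
           ennreal (r * (v - u)) < (\<integral>\<^sup>+x\<in>{u..v}. ennreal (f x) \<partial>lborel))}" for q r
  have "AE t in lebesgue. t \<notin> E q r" if "0 \<le> q" "q < r" for q r
    using negligible_excess_average[OF assms that] unfolding E_def negligible_iff_null_sets
    by (rule AE_not_in)
  then have *: "AE t in lborel. 0 \<le> q \<and> q < r \<longrightarrow> t \<notin> E q r" for q r
    by (cases "0 \<le> q \<and> q < r") (auto simp: AE_completion_iff)
  have "AE t in lborel. \<forall>q\<in>\<rat>. \<forall>r\<in>\<rat>. 0 \<le> q \<and> q < r \<longrightarrow> t \<notin> E q r"
    using * by (auto simp: AE_ball_countable countable_rat)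
  then show ?thesis
  proof eventually_elim
    case (elim t)
    show ?case
    proof (intro allI impI)
      fix r assume "f t < r"
      then obtain q where q: "q \<in> \<rat>" "f t < q" "q < r" using Rats_dense_in_real by blast
      then obtain p where p: "p \<in> \<rat>" "q < p" "p < r" using Rats_dense_in_real by blast
      have "0 \<le> q" using q assms(2)[of t] by linarith
      then have "t \<notin> E q p" using elim p q by auto
      then obtain d where d: "d > 0" "\<And>u v. u \<le> t \<and> t \<le> v \<and> u < v \<and> v - u < d \<Longrightarrow>
           (\<integral>\<^sup>+x\<in>{u..v}. ennreal (f x) \<partial>lborel) \<le> ennreal (p * (v - u))"
        using q unfolding E_def by (force simp: not_less)
      have "ennreal (p * (v - u)) \<le> ennreal (r * (v - u))" if "u < v" for u v
        using p that by (intro ennreal_leI mult_right_mono) auto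
      then show "\<exists>d>0. \<forall>u v. u \<le> t \<and> t \<le> v \<and> u < v \<and> v - u < d \<longrightarrow>
           (\<integral>\<^sup>+x\<in>{u..v}. ennreal (f x) \<partial>lborel) \<le> ennreal (r * (v - u))"
        using d by (meson order_trans)
    qed
  qed
qed

section \<open>Real Lipschitz functions as indefinite integrals\<close>

lemma emeasure_UN_countable_le:
  assumes "countable I" and [measurable]: "\<And>i. i \<in> I \<Longrightarrow> X i \<in> sets M"
  shows "emeasure M (\<Union>i\<in>I. X i) \<le> (\<integral>\<^sup>+i. emeasure M (X i) \<partial>count_space I)"
proof -
  have "emeasure M (\<Union>i\<in>I. X i) = (\<integral>\<^sup>+x. indicator (\<Union>i\<in>I. X i) x \<partial>M)"
    using assms by (subst nn_integral_indicator) (auto intro!: sets.countable_UN'')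
  also have "\<dots> \<le> (\<integral>\<^sup>+x. (\<integral>\<^sup>+i. indicator (X i) x \<partial>count_space I) \<partial>M)"
  proof (rule nn_integral_mono)
    fix x show "indicator (\<Union>i\<in>I. X i) x \<le> (\<integral>\<^sup>+i. indicator (X i) x \<partial>count_space I)"
    proof (cases "x \<in> (\<Union>i\<in>I. X i)")
      case True
      then obtain i where i: "i \<in> I" "x \<in> X i" by auto
      have "indicator (X i) x \<le> (\<integral>\<^sup>+i. indicator (X i) x \<partial>count_space I)"
        using i(1) by (rule nn_integral_ge_point)
      then show ?thesis using i True by simp
    qed simp
  qed
  also have "\<dots> = (\<integral>\<^sup>+i. (\<integral>\<^sup>+x. indicator (X i) x \<partial>M) \<partial>count_space I)"
    using assms by (intro nn_integral_count_space_nn_integral) auto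
  also have "\<dots> = (\<integral>\<^sup>+i. emeasure M (X i) \<partial>count_space I)"
    by (intro nn_integral_cong) simp
  finally show ?thesis .
qed

lemma emeasure_lborel_lmeasurable:
  assumes "A \<in> sets borel" "A \<in> lmeasurable"
  shows "emeasure lborel A = ennreal (measure lebesgue A)"
proof -
  have "emeasure lborel A = emeasure lebesgue A" using assms(1) by simp
  also have "\<dots> = ennreal (measure lebesgue A)" using assms(2) by (rule emeasure_eq_measure2)
  finally show ?thesis .
qed

text \<open>
  On intervals the inequality is the Lipschitz condition. It passes to Borel sets by covering them with
  nonoverlapping intervals of nearly the same total length.
\<close>

lemma emeasure_interval_measure_le_lborel:
  fixes F :: "real \<Rightarrow> real"
  assumes mono: "\<And>x y. x \<le> y \<Longrightarrow> F x \<le> F y" and lip: "C-lipschitz_on UNIV F"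
    and A: "A \<in> sets borel" "A \<subseteq> {a..b}"
  shows "emeasure (interval_measure F) A \<le> ennreal C * emeasure lborel A"
proof (rule ennreal_le_epsilon)
  fix e :: real assume "e > 0"
  have C: "C \<ge> 0" using lip by (rule lipschitz_on_nonneg)
  define \<eta> where "\<eta> = e / (C + 1)"
  have "\<eta> > 0" using C \<open>e > 0\<close> by (simp add: \<eta>_def)
  have cont: "continuous_on UNIV F" using lip by (rule lipschitz_on_continuous_on)
  have A_l: "A \<in> lmeasurable" using A bounded_subset[OF bounded_closed_interval A(2)]
    by (intro bounded_set_imp_lmeasurable) auto
  obtain \<D> where \<D>: "countable \<D>"
      "\<And>K. K \<in> \<D> \<Longrightarrow> K \<subseteq> cbox a b \<and> K \<noteq> {} \<and> (\<exists>c d. K = cbox c d)"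
      "pairwise (\<lambda>A B. interior A \<inter> interior B = {}) \<D>"
      "A \<subseteq> \<Union>\<D>" "\<Union>\<D> \<in> lmeasurable" "measure lebesgue (\<Union>\<D>) \<le> measure lebesgue A + \<eta>"
  proof (rule measurable_outer_intervals_bounded[OF A_l _ \<open>\<eta> > 0\<close>])
    show "A \<subseteq> cbox a b" using A by auto
  qed (rule that)
  let ?N = "interval_measure F"
  have Icc: "\<exists>c d. c \<le> d \<and> K = {c..d}" if K: "K \<in> \<D>" for K
  proof -
    obtain c d where "K = {c..d}" "K \<noteq> {}" using \<D>(2)[OF K] by auto
    then show ?thesis by (intro exI[of _ c] exI[of _ d]) auto
  qed
  have meas: "K \<in> sets borel" "interior K \<in> sets borel" if "K \<in> \<D>" for K
    using Icc[OF that] by auto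
  have "emeasure ?N A \<le> emeasure ?N (\<Union>K\<in>\<D>. K)"
    using \<D> meas by (intro emeasure_mono) (auto intro!: sets.countable_UN'')
  also have "\<dots> \<le> (\<integral>\<^sup>+K. emeasure ?N K \<partial>count_space \<D>)"
    by (rule emeasure_UN_countable_le) (use \<D>(1) meas in auto)
  also have "\<dots> \<le> (\<integral>\<^sup>+K. ennreal C * emeasure lborel (interior K) \<partial>count_space \<D>)"
  proof (intro nn_integral_mono)
    fix K assume "K \<in> space (count_space \<D>)"
    then obtain c d where cd: "c \<le> d" "K = {c..d}" using Icc[of K] by auto
    have "F d - F c \<le> C * (d - c)"
      using lipschitz_onD[OF lip, of d c] cd by (auto simp: dist_real_def)
    then show "emeasure ?N K \<le> ennreal C * emeasure lborel (interior K)"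
      using cd C emeasure_interval_measure_Icc[OF cd(1) mono cont]
      by (auto simp: interior_atLeastAtMost_real ennreal_mult[symmetric] intro!: ennreal_leI)
  qed
  also have "\<dots> = ennreal C * emeasure lborel (\<Union>K\<in>\<D>. interior K)"
    using \<D> meas
    by (subst emeasure_UN_countable) (auto simp: nn_integral_cmult disjoint_family_on_def pairwise_def)
  also have "\<dots> \<le> ennreal C * emeasure lborel (\<Union>\<D>)"
    using \<D>(1) meas
    by (intro mult_left_mono emeasure_mono) (auto intro!: sets.countable_Union dest: interior_subset[THEN subsetD])
  also have "emeasure lborel (\<Union>\<D>) = ennreal (measure lebesgue (\<Union>\<D>))"
  proof -
    have "\<Union>\<D> \<in> sets lborel" using \<D>(1) meas by (auto intro!: sets.countable_Union)
    then show ?thesis using \<D>(5) by (intro emeasure_lborel_lmeasurable) auto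
  qed
  also have "\<dots> \<le> ennreal (measure lebesgue A + \<eta>)" using \<D> by (intro ennreal_leI)
  also have "\<dots> = emeasure lborel A + ennreal \<eta>"
    using A \<open>\<eta> > 0\<close> by (simp add: emeasure_lborel_lmeasurable[OF _ A_l])
  also have "ennreal C * \<dots> = ennreal C * emeasure lborel A + ennreal (C * \<eta>)"
    using C by (simp add: distrib_left ennreal_mult')
  also have "\<dots> \<le> ennreal C * emeasure lborel A + ennreal e"
    using C \<open>e > 0\<close> by (intro add_left_mono ennreal_leI) (simp add: \<eta>_def field_simps)
  finally show "emeasure ?N A \<le> ennreal C * emeasure lborel A + ennreal e"
    by (simp add: mult_left_mono)
qed

text \<open>
  The Stieltjes measure of \<open>F\<close> is at most \<open>C\<close> times the Lebesgue measure; \<open>h\<close> is its Radon-Nikodym density.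
\<close>

lemma lipschitz_mono_density:
  fixes F :: "real \<Rightarrow> real"
  assumes mono: "\<And>x y. x \<le> y \<Longrightarrow> F x \<le> F y" and lip: "C-lipschitz_on UNIV F"
  obtains h :: "real \<Rightarrow> real" where "h \<in> borel_measurable borel" "\<And>t. 0 \<le> h t" "\<And>t. h t \<le> C"
    "\<And>u v. u \<le> v \<Longrightarrow> (\<integral>\<^sup>+t\<in>{u..v}. ennreal (h t) \<partial>lborel) = ennreal (F v - F u)"
proof -
  let ?N = "interval_measure F"
  have C: "C \<ge> 0" using lip by (rule lipschitz_on_nonneg)
  have cont: "continuous_on UNIV F" using lip by (rule lipschitz_on_continuous_on)
  have le: "emeasure ?N A \<le> ennreal C * emeasure lborel A" if "A \<in> sets borel" "A \<subseteq> {a..b}" for A a b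
    using emeasure_interval_measure_le_lborel[OF mono lip that] .
  have cover: "(\<Union>n::nat. A \<inter> {-real n..real n}) = A" for A
  proof safe
    fix x assume "x \<in> A"
    obtain n :: nat where "\<bar>x\<bar> \<le> real n" using real_arch_simple by blast
    then show "x \<in> (\<Union>n::nat. A \<inter> {-real n..real n})" using \<open>x \<in> A\<close> by (auto intro!: exI[of _ n])
  qed
  have ac: "absolutely_continuous lborel ?N"
    unfolding absolutely_continuous_def
  proof
    fix A :: "real set" assume "A \<in> null_sets lborel"
    then have A: "A \<in> sets borel" "emeasure lborel A = 0" by auto
    have "A \<inter> {-real n..real n} \<in> null_sets ?N" for n :: nat
    proof -
      have "emeasure lborel (A \<inter> {-real n..real n}) = 0"
        using A emeasure_mono[of "A \<inter> {-real n..real n}" A lborel] by auto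
      then have "emeasure ?N (A \<inter> {-real n..real n}) \<le> 0"
        using le[of "A \<inter> {-real n..real n}" "-real n" "real n"] A by auto
      then show ?thesis using A by (auto intro!: null_setsI)
    qed
    then have "(\<Union>n::nat. A \<inter> {-real n..real n}) \<in> null_sets ?N" by (rule null_sets_UN)
    then show "A \<in> null_sets ?N" unfolding cover .
  qed
  obtain h where h[measurable]: "h \<in> borel_measurable lborel" and N: "density lborel h = ?N"
    using sigma_finite_measure.Radon_Nikodym[OF sigma_finite_lborel ac] by auto
  \<comment> \<open>where \<open>h > C\<close> by a definite amount, the measure would exceed \<open>C\<close> times the Lebesgue measure\<close>
  have AEn: "AE x in lborel. x \<notin> {x. h x > ennreal (C + 1 / Suc k)} \<inter> {-real n..real n}" for n k :: nat
  proof (rule AE_not_in, rule null_setsI)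
    let ?A = "{x. h x > ennreal (C + 1 / Suc k)} \<inter> {-real n..real n}"
    show A[measurable]: "?A \<in> sets lborel" by simp
    have "emeasure lborel ?A \<le> emeasure lborel {-real n..real n}" by (intro emeasure_mono) auto
    also have "\<dots> < \<infinity>" by (intro emeasure_bounded_finite) auto
    finally have fin: "emeasure lborel ?A = ennreal (measure lborel ?A)"
      by (simp add: emeasure_eq_ennreal_measure less_top)
    have "ennreal (C + 1 / Suc k) * emeasure lborel ?A = (\<integral>\<^sup>+x. ennreal (C + 1 / Suc k) * indicator ?A x \<partial>lborel)"
      by (simp add: nn_integral_cmult_indicator)
    also have "\<dots> \<le> (\<integral>\<^sup>+x. h x * indicator ?A x \<partial>lborel)"
      by (intro nn_integral_mono) (auto split: split_indicator)
    also have "\<dots> = emeasure ?N ?A" unfolding N[symmetric] by (subst emeasure_density) auto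
    also have "\<dots> \<le> ennreal C * emeasure lborel ?A" by (rule le) auto
    finally have "ennreal ((C + 1 / Suc k) * measure lborel ?A) \<le> ennreal (C * measure lborel ?A)"
      using C unfolding fin by (simp add: ennreal_mult)
    then have "(C + 1 / Suc k) * measure lborel ?A \<le> C * measure lborel ?A"
      using C by (subst (asm) ennreal_le_iff) auto
    then have "1 / Suc k * measure lborel ?A \<le> 0" by (simp add: algebra_simps)
    then have "measure lborel ?A \<le> 0" by (simp add: divide_le_0_iff)
    then show "emeasure lborel ?A = 0" unfolding fin by (simp add: ennreal_eq_0_iff)
  qed
  have "AE x in lborel. \<forall>n k::nat. x \<notin> {x. h x > ennreal (C + 1 / Suc k)} \<inter> {-real n..real n}"
    unfolding AE_all_countable using AEn by blast
  then have AEh: "AE x in lborel. h x \<le> ennreal C"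
  proof eventually_elim
    case (elim x)
    obtain n :: nat where "\<bar>x\<bar> \<le> real n" using real_arch_simple by blast
    then have *: "h x \<le> ennreal (C + 1 / Suc k)" for k
      using elim[rule_format, of k n] by (auto simp: not_less)
    have "(\<lambda>k. ennreal (C + 1 / Suc k)) \<longlonglongrightarrow> ennreal (C + 0)"
      by (intro tendsto_ennrealI tendsto_add tendsto_const LIMSEQ_Suc[OF lim_1_over_n])
    then show "h x \<le> ennreal C"
      using * by (intro LIMSEQ_le_const[of _ "ennreal C" "h x"]) auto
  qed
  define g where "g x = enn2real (min (h x) (ennreal C))" for x
  show thesis
  proof (rule that[of g])
    show "g \<in> borel_measurable borel" unfolding g_def using h by simp
    show "0 \<le> g t" for t by (simp add: g_def)
    show "g t \<le> C" for t
      unfolding g_def using C by (metis enn2real_ennreal enn2real_mono ennreal_less_top min.cobounded2)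
    fix u v :: real assume "u \<le> v"
    have "(\<integral>\<^sup>+t\<in>{u..v}. ennreal (g t) \<partial>lborel) = (\<integral>\<^sup>+t\<in>{u..v}. h t \<partial>lborel)"
    proof (rule nn_integral_cong_AE)
      show "AE x in lborel. ennreal (g x) * indicator {u..v} x = h x * indicator {u..v} x"
        using AEh
      proof eventually_elim
        case (elim x)
        then have "h x < top" using ennreal_less_top le_less_trans by blast
        then show ?case using elim by (simp add: g_def min_absorb1)
      qed
    qed
    also have "\<dots> = emeasure ?N {u..v}" unfolding N[symmetric] by (subst emeasure_density) auto
    also have "\<dots> = ennreal (F v - F u)" using emeasure_interval_measure_Icc[OF \<open>u \<le> v\<close> mono cont] .
    finally show "(\<integral>\<^sup>+t\<in>{u..v}. ennreal (g t) \<partial>lborel) = ennreal (F v - F u)" .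
  qed
qed

text \<open>
  Rademacher's theorem in dimension one, with the part of the fundamental theorem of calculus that is used
  below. Adding \<open>L * t\<close> to \<open>\<phi>\<close> makes it monotone, and then both halves of Lebesgue differentiation apply to
  its density.
\<close>

lemma lipschitz_AE_derivative:
  fixes \<phi> :: "real \<Rightarrow> real"
  assumes lip: "L-lipschitz_on UNIV \<phi>"
  obtains g :: "real \<Rightarrow> real" where "g \<in> borel_measurable borel" "\<And>t. \<bar>g t\<bar> \<le> L"
    "AE t in lborel. (\<phi> has_real_derivative g t) (at t)"
    "\<And>u v. u \<le> v \<Longrightarrow> ennreal \<bar>\<phi> v - \<phi> u\<bar> \<le> (\<integral>\<^sup>+t\<in>{u..v}. ennreal \<bar>g t\<bar> \<partial>lborel)"
proof -
  have L: "L \<ge> 0" using lip by (rule lipschitz_on_nonneg)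
  define F where "F t = \<phi> t + L * t" for t
  have lipD: "\<bar>\<phi> v - \<phi> u\<bar> \<le> L * \<bar>v - u\<bar>" for u v
    using lipschitz_onD[OF lip, of v u] by (simp add: dist_real_def)
  have mono: "F x \<le> F y" if "x \<le> y" for x y
    using lipD[of x y] that by (auto simp: F_def algebra_simps)
  have lipF: "(2*L)-lipschitz_on UNIV F"
  proof (rule lipschitz_onI)
    fix x y show "dist (F x) (F y) \<le> 2 * L * dist x y"
    proof -
      have "\<bar>F x - F y\<bar> \<le> \<bar>\<phi> x - \<phi> y\<bar> + \<bar>L * (x - y)\<bar>" unfolding F_def by (simp add: algebra_simps abs_if)
      also have "\<dots> \<le> L * \<bar>x - y\<bar> + L * \<bar>x - y\<bar>" using lipD[of x y] L by (simp add: abs_mult)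
      finally show ?thesis by (simp add: dist_real_def)
    qed
  qed (use L in simp)
  obtain h where h[measurable]: "h \<in> borel_measurable borel" and h0: "\<And>t. 0 \<le> h t" and hL: "\<And>t. h t \<le> 2 * L"
    and hF: "\<And>u v. u \<le> v \<Longrightarrow> (\<integral>\<^sup>+t\<in>{u..v}. ennreal (h t) \<partial>lborel) = ennreal (F v - F u)"
    by (rule lipschitz_mono_density[OF mono lipF]) (assumption, rule that)
  \<comment> \<open>the density of \<open>L * t - \<phi> t\<close>; upper bounds for its averages are lower bounds for those of \<open>h\<close>\<close>
  define h' where "h' t = 2 * L - h t" for t
  have h'[measurable]: "h' \<in> borel_measurable borel" unfolding h'_def by measurable
  have h'0: "0 \<le> h' t" "h' t \<le> 2 * L" for t using h0 hL by (auto simp: h'_def)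
  have h'F: "(\<integral>\<^sup>+t\<in>{u..v}. ennreal (h' t) \<partial>lborel) = ennreal (2 * L * (v - u) - (F v - F u))" if "u \<le> v" for u v
  proof -
    have "(\<integral>\<^sup>+t\<in>{u..v}. ennreal (h' t) \<partial>lborel) + ennreal (F v - F u)
        = (\<integral>\<^sup>+t\<in>{u..v}. ennreal (h' t) \<partial>lborel) + (\<integral>\<^sup>+t\<in>{u..v}. ennreal (h t) \<partial>lborel)"
      using hF that by simp
    also have "\<dots> = (\<integral>\<^sup>+t. ennreal (2 * L) * indicator {u..v} t \<partial>lborel)"
      by (subst nn_integral_add[symmetric])
         (auto intro!: nn_integral_cong split: split_indicator simp: h0 hL h'_def ennreal_plus[symmetric] simp del: ennreal_plus)
    also have "\<dots> = ennreal (2 * L * (v - u))"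
      using that L by (simp add: nn_integral_cmult_indicator ennreal_mult)
    finally have *: "(\<integral>\<^sup>+t\<in>{u..v}. ennreal (h' t) \<partial>lborel) + ennreal (F v - F u) = ennreal (2 * L * (v - u))" .
    show ?thesis
    proof (cases "(\<integral>\<^sup>+t\<in>{u..v}. ennreal (h' t) \<partial>lborel)")
      case (real x)
      then have "ennreal (x + (F v - F u)) = ennreal (2 * L * (v - u))"
        using * mono[OF that] by simp
      then have "x + (F v - F u) = 2 * L * (v - u)"
        using real mono[OF that] that L by (subst (asm) ennreal_inj) auto
      then show ?thesis using real by (simp add: algebra_simps)
    next
      case top
      with * show ?thesis by simp
    qed
  qed
  define g where "g t = h t - L" for t
  show thesis
  proof (rule that[of g])
    show "g \<in> borel_measurable borel" unfolding g_def by measurable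
    show "\<bar>g t\<bar> \<le> L" for t using h0[of t] hL[of t] by (auto simp: g_def abs_if)
    show "AE t in lborel. (\<phi> has_real_derivative g t) (at t)"
      using AE_average_upper[OF h h0 hL] AE_average_upper[OF h' h'0]
    proof eventually_elim
      case (elim t)
      show ?case unfolding has_field_derivative_iff
      proof (rule order_tendstoI)
        fix a assume "a < g t"
        define r where "r = (h' t + (L - a)) / 2"
        have r: "h' t < r" "r < L - a" using \<open>a < g t\<close> by (auto simp: r_def g_def h'_def)
        obtain d where d: "d > 0" "\<And>u v. u \<le> t \<and> t \<le> v \<and> u < v \<and> v - u < d \<Longrightarrow>
           (\<integral>\<^sup>+x\<in>{u..v}. ennreal (h' x) \<partial>lborel) \<le> ennreal (r * (v - u))" using elim(2) r(1) by blast
        have le: "2 * L * (v - u) - (F v - F u) \<le> r * (v - u)" if "u \<le> t \<and> t \<le> v \<and> u < v \<and> v - u < d" for u v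
          using d(2)[OF that] that h'F[of u v] r h'0[of t]
          by (simp add: ennreal_le_iff)
        have "a < (\<phi> s - \<phi> t) / (s - t)" if "s \<noteq> t" "dist s t < d" for s
        proof (cases "t < s")
          case True
          then have "\<phi> s - \<phi> t \<ge> (L - r) * (s - t)"
            using le[of t s] that by (auto simp: F_def dist_real_def algebra_simps)
          moreover have "(L - r) * (s - t) > a * (s - t)" using r True by (intro mult_strict_right_mono) auto
          ultimately have "a * (s - t) < \<phi> s - \<phi> t" by linarith
          then show ?thesis using True by (simp add: pos_less_divide_eq)
        next
          case False
          then have "\<phi> t - \<phi> s \<ge> (L - r) * (t - s)"
            using le[of s t] that by (auto simp: F_def dist_real_def algebra_simps)
          moreover have "(L - r) * (t - s) > a * (t - s)" using r False that by (intro mult_strict_right_mono) auto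
          ultimately have "a * (t - s) < \<phi> t - \<phi> s" by linarith
          then have "a < (\<phi> t - \<phi> s) / (t - s)" using False that by (simp add: pos_less_divide_eq)
          then show ?thesis by (metis minus_diff_eq minus_divide_divide)
        qed
        then show "\<forall>\<^sub>F s in at t. a < (\<phi> s - \<phi> t) / (s - t)"
          using d(1) unfolding eventually_at by blast
      next
        fix a assume "g t < a"
        define r where "r = (h t + (L + a)) / 2"
        have r: "h t < r" "r < L + a" using \<open>g t < a\<close> by (auto simp: r_def g_def)
        obtain d where d: "d > 0" "\<And>u v. u \<le> t \<and> t \<le> v \<and> u < v \<and> v - u < d \<Longrightarrow>
           (\<integral>\<^sup>+x\<in>{u..v}. ennreal (h x) \<partial>lborel) \<le> ennreal (r * (v - u))" using elim(1) r(1) by blast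
        have le: "F v - F u \<le> r * (v - u)" if "u \<le> t \<and> t \<le> v \<and> u < v \<and> v - u < d" for u v
          using d(2)[OF that] that hF[of u v] r h0[of t] by (simp add: ennreal_le_iff)
        have "(\<phi> s - \<phi> t) / (s - t) < a" if "s \<noteq> t" "dist s t < d" for s
        proof (cases "t < s")
          case True
          then have "\<phi> s - \<phi> t \<le> (r - L) * (s - t)"
            using le[of t s] that by (auto simp: F_def dist_real_def algebra_simps)
          moreover have "(r - L) * (s - t) < a * (s - t)" using r True by (intro mult_strict_right_mono) auto
          ultimately have "\<phi> s - \<phi> t < a * (s - t)" by linarith
          then show ?thesis using True by (simp add: pos_divide_less_eq)
        next
          case False
          then have "\<phi> t - \<phi> s \<le> (r - L) * (t - s)"
            using le[of s t] that by (auto simp: F_def dist_real_def algebra_simps)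
          moreover have "(r - L) * (t - s) < a * (t - s)" using r False that by (intro mult_strict_right_mono) auto
          ultimately have "\<phi> t - \<phi> s < a * (t - s)" by linarith
          then have "(\<phi> t - \<phi> s) / (t - s) < a" using False that by (simp add: pos_divide_less_eq)
          then show ?thesis by (metis minus_diff_eq minus_divide_divide)
        qed
        then show "\<forall>\<^sub>F s in at t. (\<phi> s - \<phi> t) / (s - t) < a"
          using d(1) unfolding eventually_at by blast
      qed
    qed
    fix u v :: real assume "u \<le> v"
    have "ennreal (F v - F u) = (\<integral>\<^sup>+t\<in>{u..v}. ennreal (h t) \<partial>lborel)" using hF[OF \<open>u \<le> v\<close>] by simp
    also have "\<dots> \<le> (\<integral>\<^sup>+t. ennreal \<bar>g t\<bar> * indicator {u..v} t + ennreal L * indicator {u..v} t \<partial>lborel)"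
      using L by (intro nn_integral_mono)
        (auto split: split_indicator simp: g_def ennreal_plus[symmetric] simp del: ennreal_plus intro!: ennreal_leI)
    also have "\<dots> = (\<integral>\<^sup>+t\<in>{u..v}. ennreal \<bar>g t\<bar> \<partial>lborel) + ennreal (L * (v - u))"
      using \<open>u \<le> v\<close> L by (subst nn_integral_add) (auto simp: nn_integral_cmult_indicator ennreal_mult g_def)
    finally have 1: "ennreal (F v - F u) \<le> (\<integral>\<^sup>+t\<in>{u..v}. ennreal \<bar>g t\<bar> \<partial>lborel) + ennreal (L * (v - u))" .
    have "ennreal (2 * L * (v - u) - (F v - F u)) = (\<integral>\<^sup>+t\<in>{u..v}. ennreal (h' t) \<partial>lborel)" using h'F[OF \<open>u \<le> v\<close>] by simp
    also have "\<dots> \<le> (\<integral>\<^sup>+t. ennreal \<bar>g t\<bar> * indicator {u..v} t + ennreal L * indicator {u..v} t \<partial>lborel)"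
      using L by (intro nn_integral_mono)
        (auto split: split_indicator simp: g_def h'_def ennreal_plus[symmetric] simp del: ennreal_plus intro!: ennreal_leI)
    also have "\<dots> = (\<integral>\<^sup>+t\<in>{u..v}. ennreal \<bar>g t\<bar> \<partial>lborel) + ennreal (L * (v - u))"
      using \<open>u \<le> v\<close> L by (subst nn_integral_add) (auto simp: nn_integral_cmult_indicator ennreal_mult g_def)
    finally have 2: "ennreal (2 * L * (v - u) - (F v - F u)) \<le> (\<integral>\<^sup>+t\<in>{u..v}. ennreal \<bar>g t\<bar> \<partial>lborel) + ennreal (L * (v - u))" .
    show "ennreal \<bar>\<phi> v - \<phi> u\<bar> \<le> (\<integral>\<^sup>+t\<in>{u..v}. ennreal \<bar>g t\<bar> \<partial>lborel)"
    proof (cases "(\<integral>\<^sup>+t\<in>{u..v}. ennreal \<bar>g t\<bar> \<partial>lborel)")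
      case (real x)
      have "F v - F u \<le> x + L * (v - u)"
        using 1 real L \<open>u \<le> v\<close> by (simp add: ennreal_plus[symmetric] del: ennreal_plus)
      moreover have "2 * L * (v - u) - (F v - F u) \<le> x + L * (v - u)"
        using 2 real L \<open>u \<le> v\<close> by (simp add: ennreal_plus[symmetric] del: ennreal_plus)
      ultimately have "\<bar>\<phi> v - \<phi> u\<bar> \<le> x" unfolding F_def by (simp add: algebra_simps abs_le_iff)
      then show ?thesis using real by (simp add: ennreal_leI)
    qed simp
  qed
qed

section \<open>The metric derivative of a Lipschitz curve\<close>

text \<open>
  The function \<open>\<phi> n = dist (\<gamma> _) (\<gamma> (q n))\<close> is Lipschitz for each rational \<open>q n\<close>, with a derivative \<open>g n\<close>; let \<open>m\<close> be the
  supremum of all \<open>\<bar>g n\<bar>\<close>. The triangle inequality bounds the difference quotient of \<open>\<gamma>\<close> from below by that of \<open>\<phi> n\<close>,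
  hence by \<open>\<bar>g n\<bar>\<close> in the limit. Conversely, letting \<open>q n\<close> tend to \<open>u\<close> gives
  \<open>dist (\<gamma> u) (\<gamma> v) \<le> \<integral> m\<close> over \<open>[u, v]\<close>, and Lebesgue differentiation of \<open>m\<close> bounds the quotient from above.
\<close>

lemma lipschitz_metric_derivative:
  fixes \<gamma> :: "real \<Rightarrow> 'a::metric_space"
  assumes lip: "L-lipschitz_on UNIV \<gamma>"
  obtains m :: "real \<Rightarrow> real" where "m \<in> borel_measurable borel" "\<And>t. 0 \<le> m t" "\<And>t. m t \<le> L"
    "AE t in lborel. ((\<lambda>s. dist (\<gamma> t) (\<gamma> s) / \<bar>t - s\<bar>) \<longlongrightarrow> m t) (at t)"
    "\<And>u v. u \<le> v \<Longrightarrow> ennreal (dist (\<gamma> u) (\<gamma> v)) \<le> (\<integral>\<^sup>+t\<in>{u..v}. ennreal (m t) \<partial>lborel)"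
proof -
  have L: "L \<ge> 0" using lip by (rule lipschitz_on_nonneg)
  define q :: "nat \<Rightarrow> real" where "q = from_nat_into \<rat>"
  have range_q: "range q = \<rat>"
    unfolding q_def by (rule range_from_nat_into) (use countable_rat Rats_0 in auto)
  define \<phi> where "\<phi> n t = dist (\<gamma> t) (\<gamma> (q n))" for n t
  have \<phi>_le: "\<bar>\<phi> n s - \<phi> n t\<bar> \<le> dist (\<gamma> s) (\<gamma> t)" for n s t
    unfolding \<phi>_def by (metis abs_dist_diff_le dist_commute)
  define P where "P n g \<longleftrightarrow> g \<in> borel_measurable borel \<and> (\<forall>t. \<bar>g t\<bar> \<le> L) \<and>
    (AE t in lborel. (\<phi> n has_real_derivative g t) (at t)) \<and>
    (\<forall>u v. u \<le> v \<longrightarrow> ennreal \<bar>\<phi> n v - \<phi> n u\<bar> \<le> (\<integral>\<^sup>+t\<in>{u..v}. ennreal \<bar>g t\<bar> \<partial>lborel))"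
    for n g
  have "\<exists>g. P n g" for n
  proof -
    have "L-lipschitz_on UNIV (\<phi> n)"
    proof (rule lipschitz_onI)
      fix s t show "dist (\<phi> n s) (\<phi> n t) \<le> L * dist s t"
        using \<phi>_le[of n s t] lipschitz_onD[OF lip, of s t] by (simp add: dist_real_def)
    qed (rule L)
    then show ?thesis
    proof (rule lipschitz_AE_derivative)
      fix g assume "g \<in> borel_measurable borel" "\<And>t. \<bar>g t\<bar> \<le> L"
        "AE t in lborel. (\<phi> n has_real_derivative g t) (at t)"
        "\<And>u v. u \<le> v \<Longrightarrow> ennreal \<bar>\<phi> n v - \<phi> n u\<bar> \<le> (\<integral>\<^sup>+t\<in>{u..v}. ennreal \<bar>g t\<bar> \<partial>lborel)"
      then have "P n g" unfolding P_def by blast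
      then show ?thesis by (intro exI[of _ g])
    qed
  qed
  then obtain g where "\<And>n. P n (g n)" by metis
  then have g: "\<And>n. g n \<in> borel_measurable borel" "\<And>n t. \<bar>g n t\<bar> \<le> L"
    "\<And>n. AE t in lborel. (\<phi> n has_real_derivative g n t) (at t)"
    "\<And>n u v. u \<le> v \<Longrightarrow> ennreal \<bar>\<phi> n v - \<phi> n u\<bar> \<le> (\<integral>\<^sup>+t\<in>{u..v}. ennreal \<bar>g n t\<bar> \<partial>lborel)"
    unfolding P_def by blast+
  define m where "m t = (SUP n. \<bar>g n t\<bar>)" for t
  have bdd: "bdd_above (range (\<lambda>n. \<bar>g n t\<bar>))" for t using g(2) by (intro bdd_aboveI2[of _ _ L]) auto
  have gm: "\<bar>g n t\<bar> \<le> m t" for n t unfolding m_def using bdd by (intro cSUP_upper) auto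
  have m_b: "m \<in> borel_measurable borel"
    unfolding m_def using g(1) bdd by (intro borel_measurable_cSUP) auto
  have m0: "0 \<le> m t" for t using gm[of 0 t] by linarith
  have mL: "m t \<le> L" for t unfolding m_def using g(2) by (intro cSUP_least) auto
  have dist_le: "ennreal (dist (\<gamma> u) (\<gamma> v)) \<le> (\<integral>\<^sup>+t\<in>{u..v}. ennreal (m t) \<partial>lborel)" if uv: "u \<le> v" for u v
  proof (rule ennreal_le_epsilon)
    fix e :: real assume "e > 0"
    define d where "d = e / (2 * L + 1)"
    have d: "d > 0" "2 * L * d \<le> e" using \<open>e > 0\<close> L by (auto simp: d_def field_simps)
    obtain r where r: "r \<in> \<rat>" "u < r" "r < u + d"
      using Rats_dense_in_real[of u "u + d"] d by auto
    obtain n where "q n = r" using r(1) unfolding range_q[symmetric] by blast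
    with r have n: "u < q n" "q n < u + d" by simp_all
    have "dist (\<gamma> u) (\<gamma> (q n)) \<le> L * dist u (q n)" using lipschitz_onD[OF lip] by auto
    also have "\<dots> \<le> L * d" using n L by (intro mult_left_mono) (auto simp: dist_real_def)
    finally have 1: "dist (\<gamma> u) (\<gamma> (q n)) \<le> L * d" .
    have "dist (\<gamma> u) (\<gamma> v) \<le> \<bar>\<phi> n v - \<phi> n u\<bar> + 2 * dist (\<gamma> u) (\<gamma> (q n))"
      unfolding \<phi>_def using dist_triangle2[of "\<gamma> u" "\<gamma> v" "\<gamma> (q n)"] by linarith
    then have "ennreal (dist (\<gamma> u) (\<gamma> v)) \<le> ennreal (\<bar>\<phi> n v - \<phi> n u\<bar> + e)"
      using 1 d by (intro ennreal_leI) linarith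
    also have "\<dots> = ennreal \<bar>\<phi> n v - \<phi> n u\<bar> + ennreal e" using \<open>e > 0\<close> by simp
    also have "\<dots> \<le> (\<integral>\<^sup>+t\<in>{u..v}. ennreal \<bar>g n t\<bar> \<partial>lborel) + ennreal e"
      using g(4)[OF uv] by (intro add_right_mono)
    also have "\<dots> \<le> (\<integral>\<^sup>+t\<in>{u..v}. ennreal (m t) \<partial>lborel) + ennreal e"
      using gm by (intro add_right_mono nn_integral_mono mult_right_mono ennreal_leI) auto
    finally show "ennreal (dist (\<gamma> u) (\<gamma> v)) \<le> (\<integral>\<^sup>+t\<in>{u..v}. ennreal (m t) \<partial>lborel) + ennreal e" .
  qed
  have "AE t in lborel. \<forall>n. (\<phi> n has_real_derivative g n t) (at t)"
    unfolding AE_all_countable using g(3) by blast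
  then have lim: "AE t in lborel. ((\<lambda>s. dist (\<gamma> t) (\<gamma> s) / \<bar>t - s\<bar>) \<longlongrightarrow> m t) (at t)"
    using AE_average_upper[OF m_b m0 mL]
  proof eventually_elim
    case (elim t)
    show ?case
    proof (rule order_tendstoI)
      fix a assume "a < m t"
      then obtain n where n: "a < \<bar>g n t\<bar>" unfolding m_def using bdd by (auto simp: less_cSUP_iff)
      have "((\<lambda>s. (\<phi> n s - \<phi> n t) / (s - t)) \<longlongrightarrow> g n t) (at t)"
        using elim(1) unfolding has_field_derivative_iff by blast
      then have "((\<lambda>s. \<bar>(\<phi> n s - \<phi> n t) / (s - t)\<bar>) \<longlongrightarrow> \<bar>g n t\<bar>) (at t)" by (rule tendsto_rabs)
      then have "\<forall>\<^sub>F s in at t. a < \<bar>(\<phi> n s - \<phi> n t) / (s - t)\<bar>" using n by (rule order_tendstoD)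
      then show "\<forall>\<^sub>F s in at t. a < dist (\<gamma> t) (\<gamma> s) / \<bar>t - s\<bar>"
      proof (rule eventually_mono)
        fix s assume "a < \<bar>(\<phi> n s - \<phi> n t) / (s - t)\<bar>"
        also have "\<dots> \<le> dist (\<gamma> t) (\<gamma> s) / \<bar>t - s\<bar>"
          using \<phi>_le[of n s t] by (auto simp: abs_divide dist_commute abs_minus_commute intro!: divide_right_mono)
        finally show "a < dist (\<gamma> t) (\<gamma> s) / \<bar>t - s\<bar>" .
      qed
    next
      fix a assume a: "m t < a"
      define r where "r = (m t + a) / 2"
      have r: "m t < r" "r < a" using a by (auto simp: r_def)
      obtain d where d: "d > 0" "\<And>u v. u \<le> t \<and> t \<le> v \<and> u < v \<and> v - u < d \<Longrightarrow>
         (\<integral>\<^sup>+x\<in>{u..v}. ennreal (m x) \<partial>lborel) \<le> ennreal (r * (v - u))" using elim(2) r(1) by blast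
      have le: "dist (\<gamma> u) (\<gamma> v) \<le> r * (v - u)" if "u \<le> t \<and> t \<le> v \<and> u < v \<and> v - u < d" for u v
      proof -
        have "ennreal (dist (\<gamma> u) (\<gamma> v)) \<le> ennreal (r * (v - u))"
          using dist_le[of u v] d(2)[OF that] that by simp
        moreover have "0 \<le> r * (v - u)" using r m0[of t] that by simp
        ultimately show ?thesis by (simp add: ennreal_le_iff)
      qed
      have "dist (\<gamma> t) (\<gamma> s) / \<bar>t - s\<bar> < a" if "s \<noteq> t" "dist s t < d" for s
      proof -
        have "dist (\<gamma> t) (\<gamma> s) \<le> r * \<bar>t - s\<bar>"
          using le[of t s] le[of s t] that by (cases "t < s") (auto simp: dist_commute dist_real_def)
        also have "\<dots> < a * \<bar>t - s\<bar>" using r that by (intro mult_strict_right_mono) auto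
        finally show ?thesis using that by (simp add: pos_divide_less_eq)
      qed
      then show "\<forall>\<^sub>F s in at t. dist (\<gamma> t) (\<gamma> s) / \<bar>t - s\<bar> < a"
        using d(1) unfolding eventually_at by blast
    qed
  qed
  show thesis by (rule that[OF m_b m0 mL lim dist_le])
qed

text \<open>
  Reduction to a curve on the whole line by freezing \<open>\<gamma>\<close> outside \<open>[a, b]\<close>, which changes no difference quotient
  at small distance from an interior point.
\<close>

lemma local_metric_derivative:
  fixes \<gamma> :: "real \<Rightarrow> 'a::metric_space"
  assumes lip: "L-lipschitz_on {a..b} \<gamma>" and I: "{a..b} \<subseteq> I" and "a \<le> b"
  obtains m :: "real \<Rightarrow> real" where "m \<in> borel_measurable borel" "\<And>t. 0 \<le> m t" "\<And>t. m t \<le> L"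
    "AE t in lborel. t \<in> {a<..<b} \<longrightarrow> ((\<lambda>s. dist (\<gamma> t) (\<gamma> s) / \<bar>t - s\<bar>) \<longlongrightarrow> m t) (at t)"
    "AE t in lborel. t \<in> {a<..<b} \<longrightarrow> metric_derivative \<gamma> I t = m t"
    "\<And>u v. a \<le> u \<Longrightarrow> u \<le> v \<Longrightarrow> v \<le> b \<Longrightarrow>
       ennreal (dist (\<gamma> u) (\<gamma> v)) \<le> (\<integral>\<^sup>+t\<in>{u..v}. ennreal (m t) \<partial>lborel)"
proof -
  define p where "p t = max a (min b t)" for t :: real
  have p: "p t \<in> {a..b}" for t using \<open>a \<le> b\<close> by (auto simp: p_def)
  have pid: "p t = t" if "t \<in> {a..b}" for t using that by (auto simp: p_def)
  have p_le: "\<bar>p s - p t\<bar> \<le> \<bar>s - t\<bar>" for s t by (auto simp: p_def max_def min_def)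
  have L: "L \<ge> 0" using lip by (rule lipschitz_on_nonneg)
  have "L-lipschitz_on UNIV (\<lambda>t. \<gamma> (p t))"
  proof (rule lipschitz_onI)
    fix s t show "dist (\<gamma> (p s)) (\<gamma> (p t)) \<le> L * dist s t"
      using lipschitz_onD[OF lip p p, of s t] mult_left_mono[OF p_le[of s t] L] by (simp add: dist_real_def)
  qed (rule L)
  then obtain m :: "real \<Rightarrow> real" where m: "m \<in> borel_measurable borel" "\<And>t. 0 \<le> m t" "\<And>t. m t \<le> L"
    and lim: "AE t in lborel. ((\<lambda>s. dist (\<gamma> (p t)) (\<gamma> (p s)) / \<bar>t - s\<bar>) \<longlongrightarrow> m t) (at t)"
    and le: "\<And>u v. u \<le> v \<Longrightarrow> ennreal (dist (\<gamma> (p u)) (\<gamma> (p v))) \<le> (\<integral>\<^sup>+t\<in>{u..v}. ennreal (m t) \<partial>lborel)"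
    by (rule lipschitz_metric_derivative) (rule that)
  have *: "AE t in lborel. t \<in> {a<..<b} \<longrightarrow> ((\<lambda>s. dist (\<gamma> t) (\<gamma> s) / \<bar>t - s\<bar>) \<longlongrightarrow> m t) (at t)"
    using lim
  proof eventually_elim
    case (elim t)
    show ?case
    proof
      assume t: "t \<in> {a<..<b}"
      have "\<forall>\<^sub>F s in at t. s \<in> {a<..<b}" using t by (intro eventually_at_in_open') auto
      then have "\<forall>\<^sub>F s in at t. dist (\<gamma> (p t)) (\<gamma> (p s)) / \<bar>t - s\<bar> = dist (\<gamma> t) (\<gamma> s) / \<bar>t - s\<bar>"
        by (rule eventually_mono) (use t in \<open>simp add: pid\<close>)
      then show "((\<lambda>s. dist (\<gamma> t) (\<gamma> s) / \<bar>t - s\<bar>) \<longlongrightarrow> m t) (at t)"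
        using elim by (rule Lim_transform_eventually[rotated])
    qed
  qed
  show thesis
  proof (rule that[OF m *])
    show "AE t in lborel. t \<in> {a<..<b} \<longrightarrow> metric_derivative \<gamma> I t = m t"
      using *
    proof eventually_elim
      case (elim t)
      show ?case
      proof
        assume t: "t \<in> {a<..<b}"
        have "t \<in> interior I" using t I by (intro interiorI[of "{a<..<b}"]) auto
        then have "at t within I = at t" by (rule at_within_interior)
        then show "metric_derivative \<gamma> I t = m t"
          unfolding metric_derivative_def using elim t by (simp add: tendsto_Lim)
      qed
    qed
    show "ennreal (dist (\<gamma> u) (\<gamma> v)) \<le> (\<integral>\<^sup>+t\<in>{u..v}. ennreal (m t) \<partial>lborel)"
      if "a \<le> u" "u \<le> v" "v \<le> b" for u v
      using le[of u v] that by (simp add: pid)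
  qed
qed

text \<open>
  The whole interval around \<open>t\<close> has to lie in \<open>I\<close>, so that the limit in the metric derivative relative to \<open>I\<close> is a
  two-sided one.
\<close>

definition lipschitz_near :: "(real \<Rightarrow> 'a::metric_space) \<Rightarrow> real set \<Rightarrow> real \<Rightarrow> bool" where
  "lipschitz_near \<gamma> I t \<longleftrightarrow> (\<exists>u>0. \<exists>L. {t - u..t + u} \<subseteq> I \<and> L-lipschitz_on {t - u..t + u} \<gamma>)"

text \<open>
  Every point of local Lipschitz continuity lies in an interval with rational end points on which \<open>\<gamma>\<close> is
  Lipschitz, and there are countably many such intervals.
\<close>

lemma AE_metric_derivative_limit:
  fixes \<gamma> :: "real \<Rightarrow> 'a::metric_space"
  shows "AE t in lborel. lipschitz_near \<gamma> I t \<longrightarrow>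
    ((\<lambda>s. dist (\<gamma> t) (\<gamma> s) / \<bar>t - s\<bar>) \<longlongrightarrow> metric_derivative \<gamma> I t) (at t)"
proof -
  let ?lim = "\<lambda>t. ((\<lambda>s. dist (\<gamma> t) (\<gamma> s) / \<bar>t - s\<bar>) \<longlongrightarrow> metric_derivative \<gamma> I t) (at t)"
  define good where "good p q \<longleftrightarrow> p \<le> q \<and> {p..q} \<subseteq> I \<and> (\<exists>L. L-lipschitz_on {p..q} \<gamma>)" for p q
  have "AE t in lborel. good p q \<longrightarrow> t \<in> {p<..<q} \<longrightarrow> ?lim t" for p q
  proof (cases "good p q")
    case True
    then obtain L where "L-lipschitz_on {p..q} \<gamma>" "{p..q} \<subseteq> I" "p \<le> q" unfolding good_def by blast
    then show ?thesis
    proof (rule local_metric_derivative)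
      fix m :: "real \<Rightarrow> real"
      assume "AE t in lborel. t \<in> {p<..<q} \<longrightarrow> ((\<lambda>s. dist (\<gamma> t) (\<gamma> s) / \<bar>t - s\<bar>) \<longlongrightarrow> m t) (at t)"
        "AE t in lborel. t \<in> {p<..<q} \<longrightarrow> metric_derivative \<gamma> I t = m t"
      then show ?thesis by eventually_elim simp
    qed
  qed simp
  then have "AE t in lborel. \<forall>p\<in>\<rat>. \<forall>q\<in>\<rat>. good p q \<longrightarrow> t \<in> {p<..<q} \<longrightarrow> ?lim t"
    by (auto simp: AE_ball_countable countable_rat)
  then show ?thesis
  proof eventually_elim
    case (elim t)
    show ?case
    proof
      assume "lipschitz_near \<gamma> I t"
      then obtain u L where u: "u > 0" "{t - u..t + u} \<subseteq> I" "L-lipschitz_on {t - u..t + u} \<gamma>"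
        unfolding lipschitz_near_def by blast
      obtain p where p: "p \<in> \<rat>" "t - u < p" "p < t" using Rats_dense_in_real[of "t - u" t] u(1) by auto
      obtain q where q: "q \<in> \<rat>" "t < q" "q < t + u" using Rats_dense_in_real[of t "t + u"] u(1) by auto
      have sub: "{p..q} \<subseteq> {t - u..t + u}" using p q by auto
      then have "good p q" unfolding good_def using u(2) p q lipschitz_on_subset[OF u(3) sub] by auto
      then show "?lim t" using elim p q by auto
    qed
  qed
qed


section \<open>Chains and the discrete weighted distance\<close>

text \<open>
  The cost is a left Riemann sum for the weighted length of a curve through the points of the chain.
\<close>

inductive chain :: "('a::metric_space \<Rightarrow> real) \<Rightarrow> real \<Rightarrow> 'a \<Rightarrow> 'a \<Rightarrow> real \<Rightarrow> bool"
  for K :: "'a \<Rightarrow> real" and \<epsilon> :: real where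
  chain_refl: "chain K \<epsilon> x x 0"
| chain_step: "chain K \<epsilon> x y c \<Longrightarrow> dist y z \<le> \<epsilon> \<Longrightarrow> chain K \<epsilon> x z (c + K y * dist y z)"

lemma chain_single: "dist x y \<le> \<epsilon> \<Longrightarrow> chain K \<epsilon> x y (K x * dist x y)"
  using chain_step[OF chain_refl, of x y \<epsilon> K] by simp

lemma chain_trans:
  assumes "chain K \<epsilon> y z c'" "chain K \<epsilon> x y c"
  shows "chain K \<epsilon> x z (c + c')"
  using assms
proof induction
  case (chain_step y z c' z')
  then have "chain K \<epsilon> x z' ((c + c') + K z * dist z z')" by (intro chain.chain_step) auto
  then show ?case by (simp add: add.assoc)
qed simp

lemma chain_mono:
  assumes "chain K \<epsilon> x y c" "\<epsilon> \<le> \<epsilon>'"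
  shows "chain K \<epsilon>' x y c"
  using assms by induction (auto intro: chain.intros)

lemma chain_nonneg:
  assumes "chain K \<epsilon> x y c" and "\<And>z. 0 \<le> K z"
  shows "0 \<le> c"
  using assms by induction auto

text \<open>
  The tool for all lower bounds on the cost of chains: a function whose increments along short steps are paid
  for by \<open>K\<close> telescopes along a chain.
\<close>

lemma chain_verification:
  assumes "chain K \<epsilon> x y c" and f: "\<And>p q. dist p q \<le> \<epsilon> \<Longrightarrow> f q - f p \<le> K p * dist p q"
  shows "f y - f x \<le> c"
  using assms(1)
proof induction
  case (chain_step x y c z)
  then show ?case using f[of y z] by linarith
qed simp

text \<open>
  A distance function would be an iterated infimum and supremum; the relation \<open>d(x, y) \<le> c\<close> suffices and
  avoids them.
\<close>

definition reach :: "('a::metric_space \<Rightarrow> real) \<Rightarrow> 'a \<Rightarrow> 'a \<Rightarrow> real \<Rightarrow> bool" where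
  "reach K x y c \<longleftrightarrow> (\<forall>\<epsilon>>0. \<exists>c'. c' \<le> c + \<epsilon> \<and> chain K \<epsilon> x y c')"

lemma reach_verification:
  assumes "reach K x y c" and "\<epsilon> > 0" and f: "\<And>p q. dist p q \<le> \<epsilon> \<Longrightarrow> f q - f p \<le> K p * dist p q"
  shows "f y - f x \<le> c"
proof (rule field_le_epsilon)
  fix e :: real assume "e > 0"
  then have "min e \<epsilon> > 0" using assms by auto
  then obtain c' where c': "c' \<le> c + min e \<epsilon>" "chain K (min e \<epsilon>) x y c'"
    using assms(1) unfolding reach_def by blast
  have "f y - f x \<le> c'" by (rule chain_verification[OF c'(2)]) (use f in auto)
  then show "f y - f x \<le> c + e" using c' by linarith
qed

lemma reach_nonneg: "reach K x y c \<Longrightarrow> (\<And>z. 0 \<le> K z) \<Longrightarrow> 0 \<le> c"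
  using reach_verification[of K x y c 1 "\<lambda>_. 0"] by simp

lemma reach_mono: "reach K x y c \<Longrightarrow> c \<le> c' \<Longrightarrow> reach K x y c'"
  unfolding reach_def by (meson add_right_mono order_trans)

lemma reach_refl: "0 \<le> c \<Longrightarrow> reach K x x c"
  unfolding reach_def by (auto intro!: exI[of _ 0] chain_refl)

lemma reach_trans:
  assumes "reach K x y c" "reach K y z c'"
  shows "reach K x z (c + c')"
  unfolding reach_def
proof (intro allI impI)
  fix \<epsilon> :: real assume "\<epsilon> > 0"
  then have e: "\<epsilon> / 2 > 0" by simp
  obtain c1 where c1: "c1 \<le> c + \<epsilon> / 2" "chain K (\<epsilon> / 2) x y c1" using assms(1) e unfolding reach_def by blast
  obtain c2 where c2: "c2 \<le> c' + \<epsilon> / 2" "chain K (\<epsilon> / 2) y z c2" using assms(2) e unfolding reach_def by blast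
  have "chain K \<epsilon> x z (c1 + c2)"
    using chain_trans[OF c2(2) c1(2)] by (rule chain_mono) (use \<open>\<epsilon> > 0\<close> in simp)
  then show "\<exists>d. d \<le> c + c' + \<epsilon> \<and> chain K \<epsilon> x z d" using c1 c2 by (intro exI[of _ "c1 + c2"]) auto
qed

text \<open>
  A chain between nearby points is extended by one short step at each end. These steps are cheap because \<open>K\<close> is bounded
  near \<open>y\<close>.
\<close>

lemma reach_limit:
  fixes K :: "'a::metric_space \<Rightarrow> real"
  assumes K0: "\<And>z. 0 \<le> K z" and cont: "continuous_on UNIV K"
    and lim: "\<And>\<delta>. \<delta> > 0 \<Longrightarrow> \<exists>x' y' c'. dist x x' < \<delta> \<and> dist y' y < \<delta> \<and> c' \<le> c + \<delta> \<and> chain K \<delta> x' y' c'"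
  shows "reach K x y c"
  unfolding reach_def
proof (intro allI impI)
  fix \<epsilon> :: real assume "\<epsilon> > 0"
  obtain r where r: "r > 0" "\<And>y'. dist y' y < r \<Longrightarrow> dist (K y') (K y) < 1"
    using cont unfolding continuous_on_iff by (metis UNIV_I zero_less_one)
  \<comment> \<open>the total error is \<open>\<delta> * S\<close>: the excess cost of the given chain and the costs of the two extra steps\<close>
  define S where "S = 1 + K x + (K y + 1)"
  have S: "S > 0" using K0[of x] K0[of y] by (simp add: S_def)
  define \<delta> where "\<delta> = min (min \<epsilon> r) (\<epsilon> / S)"
  have "\<delta> \<le> \<epsilon> / S" by (simp add: \<delta>_def)
  then have "\<delta> * S \<le> \<epsilon>" using S by (simp add: pos_le_divide_eq)
  moreover have "\<delta> > 0" "\<delta> \<le> \<epsilon>" "\<delta> \<le> r" using \<open>\<epsilon> > 0\<close> r(1) S by (auto simp: \<delta>_def)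
  ultimately have \<delta>: "\<delta> > 0" "\<delta> \<le> \<epsilon>" "\<delta> \<le> r" "\<delta> * S \<le> \<epsilon>" by blast+
  obtain x' y' c' where x': "dist x x' < \<delta>" and y': "dist y' y < \<delta>" and c': "c' \<le> c + \<delta>" "chain K \<delta> x' y' c'"
    using lim[OF \<delta>(1)] by blast
  have "chain K \<delta> x x' (K x * dist x x')" using x' by (intro chain_single) simp
  moreover have "chain K \<delta> y' y (K y' * dist y' y)" using y' by (intro chain_single) simp
  ultimately have "chain K \<delta> x y (K x * dist x x' + (c' + K y' * dist y' y))"
    using c'(2) by (meson chain_trans)
  then have 1: "chain K \<epsilon> x y (K x * dist x x' + (c' + K y' * dist y' y))" using \<delta>(2) by (rule chain_mono)
  have "K y' \<le> K y + 1" using r(2)[of y'] y' \<delta>(3) by (auto simp: dist_real_def)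
  then have "K y' * dist y' y \<le> (K y + 1) * \<delta>" using y' K0[of y] by (intro mult_mono) auto
  moreover have "K x * dist x x' \<le> K x * \<delta>" using x' K0[of x] by (intro mult_left_mono) auto
  ultimately have "K x * dist x x' + (c' + K y' * dist y' y) \<le> c + \<delta> * S"
    using c'(1) by (simp add: S_def algebra_simps)
  with 1 \<delta>(4) show "\<exists>c'. c' \<le> c + \<epsilon> \<and> chain K \<epsilon> x y c'" by (meson add_left_mono order_trans)
qed

lemma reach_closed:
  assumes "\<And>\<delta>. \<delta> > 0 \<Longrightarrow> reach K x y (c + \<delta>)"
  shows "reach K x y c"
  unfolding reach_def
proof (intro allI impI)
  fix \<epsilon> :: real assume "\<epsilon> > 0"
  then have e: "\<epsilon> / 2 > 0" by simp
  obtain c1 where c1: "c1 \<le> c + \<epsilon> / 2 + \<epsilon> / 2" "chain K (\<epsilon> / 2) x y c1"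
    using assms[OF e] e unfolding reach_def by blast
  have "chain K \<epsilon> x y c1" using c1(2) by (rule chain_mono) (use \<open>\<epsilon> > 0\<close> in simp)
  with c1 show "\<exists>c'. c' \<le> c + \<epsilon> \<and> chain K \<epsilon> x y c'" by (intro exI[of _ c1]) auto
qed

text \<open>
  Verification with \<open>f q = \<kappa> * dist u q\<close>, truncated so that \<open>f\<close> is constant where \<open>K\<close> may be smaller than \<open>\<kappa>\<close>.
\<close>

lemma reach_local_lower_bound:
  fixes K :: "'a::metric_space \<Rightarrow> real"
  assumes K: "\<And>z. 0 \<le> K z" "\<And>z. dist u z \<le> R \<Longrightarrow> \<kappa> \<le> K z" and "R > 0" "\<kappa> \<ge> 0" and r: "reach K u v c"
  shows "\<kappa> * min (R / 2) (dist u v) \<le> c"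
proof -
  define f where "f q = \<kappa> * min (R / 2) (dist u q)" for q :: 'a
  have "f v - f u \<le> c"
  proof (rule reach_verification[OF r, of "R / 2"])
    fix p q :: 'a assume pq: "dist p q \<le> R / 2"
    have tri: "dist u q \<le> dist u p + dist p q" "dist u p \<le> dist u q + dist p q"
      using dist_triangle[of u q p] dist_triangle[of u p q] by (auto simp: dist_commute)
    show "f q - f p \<le> K p * dist p q"
    proof (cases "dist u p \<le> R")
      case True
      have "f q - f p = \<kappa> * (min (R / 2) (dist u q) - min (R / 2) (dist u p))" by (simp add: f_def right_diff_distrib)
      also have "\<dots> \<le> \<kappa> * dist p q" using tri \<open>\<kappa> \<ge> 0\<close> by (intro mult_left_mono) auto
      also have "\<dots> \<le> K p * dist p q" using K(2)[OF True] by (intro mult_right_mono) auto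
      finally show ?thesis .
    next
      case False
      then have "f q = f p" using tri pq by (auto simp: f_def)
      then show ?thesis using K(1)[of p] by simp
    qed
  qed (use \<open>R > 0\<close> in simp)
  then show ?thesis using \<open>R > 0\<close> by (simp add: f_def)
qed

text \<open>
  Around any \<open>z\<close>, even a zero of \<open>K\<close>, there is a compact annulus free of zeros, and a chain between \<open>z\<close> and a point at
  distance \<open>r\<close> has to cross it. The verification function is \<open>\<kappa> * dist z q\<close>, truncated to be constant on both sides of
  the annulus; it is used with either sign, since the cost of a step is not symmetric.
\<close>

lemma reach_separation:
  fixes K :: "'a::metric_space \<Rightarrow> real"
  assumes "proper_space TYPE('a)" and K0: "\<And>z. 0 \<le> K z" and cont: "continuous_on UNIV K"
    and fin: "finite {z. K z = 0}" and "r > 0"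
  obtains c where "c > 0" "\<And>v e. r \<le> dist z v \<Longrightarrow> reach K z v e \<or> reach K v z e \<Longrightarrow> c \<le> e"
proof -
  \<comment> \<open>below \<open>Min D\<close> there is no distance from \<open>z\<close> to another zero of \<open>K\<close>\<close>
  define D where "D = insert r (dist z ` ({w. K w = 0} - {z}))"
  have "finite D" "D \<noteq> {}" "\<And>d. d \<in> D \<Longrightarrow> d > 0" using fin \<open>r > 0\<close> by (auto simp: D_def)
  then have Min: "Min D > 0" by simp
  define b a where "b = Min D / 2" and "a = Min D / 4"
  have ab: "0 < a" "a < b" "b < Min D" using Min by (auto simp: a_def b_def)
  have "Min D \<le> r" using \<open>finite D\<close> by (intro Min_le) (auto simp: D_def)
  with ab have br: "b < r" by simp
  define A where "A = {q. a \<le> dist z q \<and> dist z q \<le> b}"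
  have Kpos: "0 < K q" if "q \<in> A" for q
  proof -
    have "K q \<noteq> 0"
    proof
      assume "K q = 0"
      then have "dist z q \<in> D" using that ab by (auto simp: D_def A_def)
      then have "Min D \<le> dist z q" using \<open>finite D\<close> by simp
      then show False using that ab by (auto simp: A_def)
    qed
    then show ?thesis using K0[of q] by simp
  qed
  have "closed A" unfolding A_def by (intro closed_Collect_conj closed_Collect_le continuous_intros)
  moreover have "bounded A" by (rule bounded_subset[OF bounded_cball[of z b]]) (auto simp: A_def)
  ultimately have cA: "compact A" using assms(1) unfolding proper_space_def by blast
  obtain \<kappa> where \<kappa>: "\<kappa> > 0" "\<And>q. q \<in> A \<Longrightarrow> \<kappa> \<le> K q"
  proof (cases "A = {}")
    case True then show ?thesis using that[of 1] by auto
  next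
    case False
    then obtain q0 where "q0 \<in> A" "\<forall>q\<in>A. K q0 \<le> K q"
      using continuous_attains_inf[OF cA False continuous_on_subset[OF cont]] by auto
    then show ?thesis using that[of "K q0"] Kpos by auto
  qed
  define \<epsilon> where "\<epsilon> = (b - a) / 4"
  have \<epsilon>: "\<epsilon> > 0" using ab by (simp add: \<epsilon>_def)
  define f where "f q = \<kappa> * max (a + \<epsilon>) (min (b - \<epsilon>) (dist z q))" for q
  have fle: "\<bar>f q - f p\<bar> \<le> K p * dist p q" if pq: "dist p q \<le> \<epsilon>" for p q
  proof -
    have tri: "dist z q \<le> dist z p + dist p q" "dist z p \<le> dist z q + dist p q"
      using dist_triangle[of z q p] dist_triangle[of z p q] by (auto simp: dist_commute)
    show ?thesis
    proof (cases "p \<in> A")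
      case True
      have "\<bar>f q - f p\<bar> = \<kappa> * \<bar>max (a + \<epsilon>) (min (b - \<epsilon>) (dist z q)) - max (a + \<epsilon>) (min (b - \<epsilon>) (dist z p))\<bar>"
        using \<kappa>(1) by (simp add: f_def right_diff_distrib[symmetric] abs_mult)
      also have "\<dots> \<le> \<kappa> * dist p q" using tri \<kappa>(1) by (intro mult_left_mono) (auto simp: max_def min_def)
      also have "\<dots> \<le> K p * dist p q" using \<kappa>(2)[OF True] by (intro mult_right_mono) auto
      finally show ?thesis .
    next
      case False
      then have "dist z p < a \<or> b < dist z p" by (auto simp: A_def)
      then have "f q = f p" using tri pq ab \<epsilon> unfolding f_def by (auto simp: max_def min_def \<epsilon>_def field_simps)
      then show ?thesis using K0[of p] by simp
    qed
  qed
  show thesis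
  proof (rule that[of "\<kappa> * ((b - a) / 2)"])
    show "\<kappa> * ((b - a) / 2) > 0" using \<kappa>(1) ab by simp
    fix v e assume v: "r \<le> dist z v" and re: "reach K z v e \<or> reach K v z e"
    have fz: "f z = \<kappa> * (a + \<epsilon>)" using ab \<epsilon> by (simp add: f_def max_def)
    have "a + \<epsilon> \<le> b - \<epsilon>" "b - \<epsilon> \<le> dist z v" using v br ab \<epsilon> by (auto simp: \<epsilon>_def field_simps)
    then have fv: "f v = \<kappa> * (b - \<epsilon>)" by (simp add: f_def)
    have "f v - f z \<le> e" using re
    proof
      assume "reach K z v e"
      then show ?thesis using \<epsilon> by (rule reach_verification) (use fle in \<open>auto simp: abs_le_iff\<close>)
    next
      assume "reach K v z e"
      then have "- f z - (- f v) \<le> e" using \<epsilon>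
        by (rule reach_verification[where f = "\<lambda>q. - f q"]) (use fle in \<open>auto simp: abs_le_iff\<close>)
      then show ?thesis by simp
    qed
    moreover have "f v - f z = \<kappa> * ((b - a) / 2)" unfolding fz fv by (simp add: \<epsilon>_def field_simps)
    ultimately show "\<kappa> * ((b - a) / 2) \<le> e" by simp
  qed
qed

section \<open>Chains of bounded cost stay bounded\<close>

lemma infinite_nn_integral_imp_unbounded:
  fixes k :: "real \<Rightarrow> real"
  assumes cont: "continuous_on {0..} k" and k0: "\<And>t. t \<ge> 0 \<Longrightarrow> k t \<ge> 0"
    and inf: "(\<integral>\<^sup>+t\<in>{0..}. ennreal (k t) \<partial>lborel) = \<infinity>"
  shows "\<exists>n::nat. B < integral {0..real n} k"
proof (rule ccontr)
  assume "\<not> (\<exists>n::nat. B < integral {0..real n} k)"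
  then have le: "integral {0..real n} k \<le> B" for n :: nat by (auto simp: not_less)
  have int: "(k has_integral integral {0..real n} k) {0..real n}" for n :: nat
    by (intro integrable_integral integrable_continuous_real continuous_on_subset[OF cont]) auto
  define f where "f n t = ennreal (k t) * indicator {0..real n} t" for n :: nat and t
  have fn: "(\<integral>\<^sup>+t. f n t \<partial>lborel) \<le> ennreal B" for n
    unfolding f_def using nn_integral_has_integral_lebesgue'[OF _ int[of n]] k0 le[of n]
    by (simp add: ennreal_leI)
  have "f n \<in> borel_measurable borel" for n
  proof -
    have "(\<lambda>t. indicator {0..real n} t *\<^sub>R k t) \<in> borel_measurable borel"
      by (intro borel_measurable_continuous_on_indicator continuous_on_subset[OF cont]) auto
    then have "(\<lambda>t. ennreal (indicator {0..real n} t *\<^sub>R k t)) \<in> borel_measurable borel" by measurable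
    moreover have "(\<lambda>t. ennreal (indicator {0..real n} t *\<^sub>R k t)) = f n"
      by (auto simp: f_def fun_eq_iff split: split_indicator)
    ultimately show ?thesis by simp
  qed
  moreover have "incseq f"
    by (auto simp: incseq_def le_fun_def f_def split: split_indicator)
  ultimately have "(\<integral>\<^sup>+t. (SUP n. f n t) \<partial>lborel) = (SUP n. \<integral>\<^sup>+t. f n t \<partial>lborel)"
    by (intro nn_integral_monotone_convergence_SUP) auto
  also have "\<dots> \<le> ennreal B" using fn by (intro SUP_least)
  finally have "(\<integral>\<^sup>+t. (SUP n. f n t) \<partial>lborel) \<le> ennreal B" .
  moreover have "ennreal (k t) * indicator {0..} t \<le> (SUP n. f n t)" for t
  proof (cases "0 \<le> t")
    case True
    obtain n :: nat where "t \<le> real n" using real_arch_simple by blast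
    then have "ennreal (k t) * indicator {0..} t = f n t" using True by (simp add: f_def)
    also have "\<dots> \<le> (SUP n. f n t)" by (rule SUP_upper) simp
    finally show ?thesis .
  qed simp
  then have "(\<integral>\<^sup>+t\<in>{0..}. ennreal (k t) \<partial>lborel) \<le> (\<integral>\<^sup>+t. (SUP n. f n t) \<partial>lborel)"
    by (intro nn_integral_mono)
  ultimately show False using inf by (simp add: top_unique)
qed

text \<open>
  Verification with a primitive of \<open>k\<close> at the distance \<open>h\<close> to \<open>S\<close>. A step from \<open>p\<close> is charged at least at the rate \<open>k (h p)\<close>, whereas the
  primitive grows by values of \<open>k\<close> at nearby points. Therefore \<open>k\<close> is first lowered by its oscillation \<open>\<eta>\<close>
  at scale \<open>\<epsilon>\<close> on \<open>[0, R + 1]\<close>; with \<open>\<eta> = 1 / R\<close> this reduces the integral over \<open>[0, R]\<close> by at most 1.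
\<close>

lemma coercive_chain_bound:
  fixes K :: "'a::metric_space \<Rightarrow> real" and k :: "real \<Rightarrow> real"
  assumes K0: "\<And>z. 0 \<le> K z"
    and cont: "continuous_on {0..} k" and k0: "\<And>t. t \<ge> 0 \<Longrightarrow> k t \<ge> 0"
    and inf: "(\<integral>\<^sup>+t\<in>{0..}. ennreal (k t) \<partial>lborel) = \<infinity>"
    and Kk: "\<And>z. k (infdist z S) \<le> K z"
  obtains R \<epsilon> where "\<epsilon> > 0" "\<And>v c. chain K \<epsilon> x v c \<Longrightarrow> c \<le> M \<Longrightarrow> infdist v S \<le> R"
proof -
  define h where "h z = infdist z S" for z
  have h0: "0 \<le> h z" for z unfolding h_def by (rule infdist_nonneg)
  have hle: "\<bar>h p - h q\<bar> \<le> dist p q" for p q unfolding h_def by (rule infdist_triangle_abs)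
  have int: "k integrable_on {a..b}" if "0 \<le> a" for a b
    by (intro integrable_continuous_real continuous_on_subset[OF cont]) (use that in auto)
  define G0 where "G0 = integral {0..h x} k"
  obtain n :: nat where n: "M + 1 + G0 < integral {0..real n} k"
    using infinite_nn_integral_imp_unbounded[OF cont k0 inf] by blast
  define R where "R = real n + 1"
  have R: "R \<ge> 1" "M + 1 + G0 < integral {0..R} k"
  proof -
    have "integral {0..real n} k \<le> integral {0..R} k"
      using k0 by (intro integral_subset_le int) (auto simp: R_def)
    then show "M + 1 + G0 < integral {0..R} k" using n by simp
  qed (simp add: R_def)
  define \<eta> where "\<eta> = 1 / R"
  have \<eta>: "\<eta> > 0" "\<eta> * R = 1" using R by (auto simp: \<eta>_def)
  have "uniformly_continuous_on {0..R + 1} k"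
    by (intro compact_uniformly_continuous continuous_on_subset[OF cont]) auto
  then obtain d where d: "d > 0"
    "\<And>s t. s \<in> {0..R + 1} \<Longrightarrow> t \<in> {0..R + 1} \<Longrightarrow> dist s t < d \<Longrightarrow> dist (k s) (k t) < \<eta>"
    using \<eta>(1) unfolding uniformly_continuous_on_def by metis
  define \<epsilon> where "\<epsilon> = min (d / 2) 1"
  have \<epsilon>: "\<epsilon> > 0" "\<epsilon> < d" "\<epsilon> \<le> 1" using d(1) by (auto simp: \<epsilon>_def)
  define g where "g t = max 0 (k t - \<eta>)" for t
  have g_cont: "continuous_on {0..} g" unfolding g_def by (intro continuous_intros cont)
  have g_int: "g integrable_on {a..b}" if "0 \<le> a" for a b
    by (intro integrable_continuous_real continuous_on_subset[OF g_cont]) (use that in auto)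
  have g0: "0 \<le> g t" for t by (simp add: g_def)
  define G where "G r = integral {0..r} g" for r
  have G_diff: "G s - G r = integral {r..s} g" if "0 \<le> r" "r \<le> s" for r s
    using Henstock_Kurzweil_Integration.integral_combine[OF that g_int[of 0 s]] by (simp add: G_def)
  have G_mono: "G r \<le> G s" if "0 \<le> r" "r \<le> s" for r s
    using G_diff[OF that] integral_nonneg[OF g_int[OF that(1)], of s] g0 by simp
  define f where "f q = G (min R (h q))" for q
  have fle: "f q - f p \<le> K p * dist p q" if pq: "dist p q \<le> \<epsilon>" for p q
  proof (cases "h p < R \<and> h p < h q")
    case True
    define s where "s = min R (h q)"
    have s: "h p \<le> s" "s \<le> R" "s \<le> h q" using True by (auto simp: s_def)
    have sp: "s - h p \<le> dist p q" using hle[of p q] s by linarith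
    have "f q - f p = integral {h p..s} g" using True s h0[of p] by (simp add: f_def G_diff s_def)
    also have "\<dots> \<le> integral {h p..s} (\<lambda>_. k (h p))"
    proof (rule integral_le)
      fix t assume t: "t \<in> {h p..s}"
      have "dist t (h p) < d" using t sp pq \<epsilon> by (auto simp: dist_real_def)
      then have "dist (k t) (k (h p)) < \<eta>" using t s h0[of p] True by (intro d(2)) auto
      then show "g t \<le> k (h p)" using k0[OF h0[of p]] by (auto simp: g_def dist_real_def)
    qed (use h0[of p] g_int in auto)
    also have "\<dots> = k (h p) * (s - h p)" using s by simp
    also have "\<dots> \<le> K p * dist p q"
      using Kk[of p] sp s K0[of p] unfolding h_def by (intro mult_mono) auto
    finally show ?thesis .
  next
    case False
    then have "min R (h q) \<le> min R (h p)" by auto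
    then have "f q \<le> f p" using R(1) h0[of q] unfolding f_def by (intro G_mono) auto
    moreover have "0 \<le> K p * dist p q" using K0[of p] by simp
    ultimately show ?thesis by linarith
  qed
  have "f x \<le> G0"
  proof -
    have "f x \<le> G (h x)" using R(1) h0[of x] unfolding f_def by (intro G_mono) auto
    also have "\<dots> \<le> G0" unfolding G_def G0_def
    proof (rule integral_le)
      fix t assume "t \<in> {0..h x}"
      then show "g t \<le> k t" using k0[of t] \<eta>(1) by (auto simp: g_def)
    qed (use int g_int in auto)
    finally show ?thesis .
  qed
  have "integral {0..R} k - 1 \<le> G R"
  proof -
    have "integral {0..R} k - integral {0..R} (\<lambda>_. \<eta>) = integral {0..R} (\<lambda>t. k t - \<eta>)"
      using int by (subst Henstock_Kurzweil_Integration.integral_diff) auto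
    also have "\<dots> \<le> G R" unfolding G_def
    proof (rule integral_le)
      show "(\<lambda>t. k t - \<eta>) integrable_on {0..R}" by (rule integrable_diff[OF int]) auto
    qed (use g_int in \<open>auto simp: g_def\<close>)
    finally show ?thesis using \<eta>(2) R(1) by (simp add: mult.commute)
  qed
  have "infdist v S \<le> R" if "chain K \<epsilon> x v c" "c \<le> M" for v c
  proof (rule ccontr)
    assume "\<not> infdist v S \<le> R"
    then have "f v = G R" by (simp add: f_def h_def)
    moreover have "f v - f x \<le> c" by (rule chain_verification[OF that(1)]) (rule fle)
    ultimately show False
      using \<open>integral {0..R} k - 1 \<le> G R\<close> \<open>f x \<le> G0\<close> R(2) that(2) by linarith
  qed
  then show thesis using \<epsilon>(1) that by blast
qed


section \<open>Limits of chains\<close>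

text \<open>
  Parametrise a chain by the accumulated cost. Each step costs at most \<open>C * \<epsilon>\<close>, which is the error made by the jumps of
  the parametrisation. The values before 0 and after \<open>c\<close> record the end points robustly: at 0 itself the value is not
  determined, since the first steps may cost nothing.
\<close>

lemma chain_step_function:
  fixes K :: "'a::metric_space \<Rightarrow> real"
  assumes "chain K \<epsilon> x y c" and "\<epsilon> \<ge> 0" and K: "\<And>z. 0 \<le> K z" and C: "0 \<le> C" "\<And>z. z \<in> B \<Longrightarrow> K z \<le> C"
    and "\<And>v c'. chain K \<epsilon> x v c' \<Longrightarrow> c' \<le> c \<Longrightarrow> v \<in> B"
  shows "\<exists>z :: real \<Rightarrow> 'a. (\<forall>s<0. z s = x) \<and> (\<forall>s>c. z s = y) \<and> range z \<subseteq> B \<and>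
    (\<forall>s s'. s \<le> s' \<longrightarrow> (\<exists>c'. c' \<le> s' - s + C * \<epsilon> \<and> chain K \<epsilon> (z s) (z s') c'))"
  using assms(1,6)
proof induction
  case (chain_refl x)
  then have "x \<in> B" using chain.chain_refl by blast
  then show ?case using C(1) \<open>\<epsilon> \<ge> 0\<close>
    by (intro exI[of _ "\<lambda>_. x"]) (auto intro!: exI[of _ 0] chain.chain_refl)
next
  case (chain_step x y c y')
  \<comment> \<open>the cost of the new step: the old parametrisation is kept up to \<open>c + w\<close> and then jumps to \<open>y'\<close>\<close>
  define w where "w = K y * dist y y'"
  have w0: "0 \<le> w" using K by (simp add: w_def)
  have c0: "0 \<le> c" using chain_nonneg[OF chain_step.hyps(1) K] .
  have inB: "v \<in> B" if "chain K \<epsilon> x v c'" "c' \<le> c + w" for v c'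
    using chain_step.prems that unfolding w_def by blast
  have "\<exists>z :: real \<Rightarrow> 'a. (\<forall>s<0. z s = x) \<and> (\<forall>s>c. z s = y) \<and> range z \<subseteq> B \<and>
    (\<forall>s s'. s \<le> s' \<longrightarrow> (\<exists>c'. c' \<le> s' - s + C * \<epsilon> \<and> chain K \<epsilon> (z s) (z s') c'))"
    by (rule chain_step.IH) (use inB w0 in force)
  then obtain z :: "real \<Rightarrow> 'a" where z: "\<forall>s<0. z s = x" "\<forall>s>c. z s = y" "range z \<subseteq> B"
    "\<forall>s s'. s \<le> s' \<longrightarrow> (\<exists>c'. c' \<le> s' - s + C * \<epsilon> \<and> chain K \<epsilon> (z s) (z s') c')"
    by blast
  have yB: "y \<in> B" "y' \<in> B"
    using inB[OF chain_step.hyps(1)] inB[OF chain.chain_step[OF chain_step.hyps]] w0 by (auto simp: w_def)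
  have wC: "w \<le> C * \<epsilon>"
    unfolding w_def using C(2)[OF yB(1)] C(1) chain_step.hyps(2) by (intro mult_mono) auto
  define z' where "z' s = (if s \<le> c + w then z s else y')" for s
  have step: "chain K \<epsilon> y y' w" unfolding w_def by (rule chain_single[OF chain_step.hyps(2)])
  have "\<exists>c'. c' \<le> s' - s + C * \<epsilon> \<and> chain K \<epsilon> (z' s) (z' s') c'" if ss: "s \<le> s'" for s s'
  proof -
    consider "s' \<le> c + w" | "c + w < s" | "c < s" "s \<le> c + w" "c + w < s'" | "s \<le> c" "c + w < s'"
      using ss w0 by linarith
    then show ?thesis
    proof cases
      case 1 then show ?thesis using z(4) ss by (simp add: z'_def)
    next
      case 2 then show ?thesis using ss C(1) \<open>\<epsilon> \<ge> 0\<close>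
        by (auto simp: z'_def intro!: exI[of _ 0] chain.chain_refl)
    next
      case 3 then show ?thesis using step ss wC z(2) by (auto simp: z'_def intro!: exI[of _ w])
    next
      case 4
      \<comment> \<open>spend \<open>w\<close> of the available \<open>s' - s\<close> on the last step\<close>
      then have "s \<le> s' - w" "s' - w > c" using w0 by auto
      moreover have "z (s' - w) = y" using z(2) \<open>s' - w > c\<close> by blast
      ultimately obtain c' where c': "c' \<le> s' - w - s + C * \<epsilon>" "chain K \<epsilon> (z s) y c'" using z(4) by force
      have "chain K \<epsilon> (z s) y' (c' + w)" by (rule chain_trans[OF step c'(2)])
      then show ?thesis using 4 c'(1) w0 by (auto simp: z'_def intro!: exI[of _ "c' + w"])
    qed
  qed
  moreover have "\<forall>s<0. z' s = x" using z(1) c0 w0 by (auto simp: z'_def)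
  moreover have "range z' \<subseteq> B" using z(3) yB by (auto simp: z'_def)
  ultimately show ?case unfolding w_def[symmetric] by (intro exI[of _ z']) (auto simp: z'_def)
qed

text \<open>
  Tychonoff's theorem in place of a diagonal subsequence. The functions to which it is applied need not be continuous, and
  what passes to the limit is a relation between any two values.
\<close>

lemma pointwise_cluster_function:
  fixes z :: "nat \<Rightarrow> 'i \<Rightarrow> 'a::metric_space"
  assumes "compact B" "\<And>n. range (z n) \<subseteq> B"
  obtains \<gamma> where
    "\<And>s s' \<delta> N. \<delta> > 0 \<Longrightarrow> \<exists>n\<ge>N. dist (z n s) (\<gamma> s) < \<delta> \<and> dist (z n s') (\<gamma> s') < \<delta>"
proof -
  have "compactin (product_topology (\<lambda>_. euclidean) UNIV) (PiE UNIV (\<lambda>_::'i. B))"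
    unfolding compactin_PiE using assms(1) by simp
  then have "compact (PiE UNIV (\<lambda>_::'i. B))" by (simp add: euclidean_product_topology)
  moreover have "filtermap z sequentially \<noteq> bot" by (simp add: filtermap_bot_iff)
  moreover have "eventually (\<lambda>f. f \<in> PiE UNIV (\<lambda>_::'i. B)) (filtermap z sequentially)"
    using assms(2) by (auto simp: eventually_filtermap PiE_UNIV_domain image_subset_iff)
  ultimately obtain \<gamma> where \<gamma>: "inf (nhds \<gamma>) (filtermap z sequentially) \<noteq> bot"
    unfolding compact_filter by blast
  show thesis
  proof (rule that[of \<gamma>])
    fix s s' :: 'i and \<delta> :: real and N :: nat assume "\<delta> > 0"
    define U where "U = {f :: 'i \<Rightarrow> 'a. dist (f s) (\<gamma> s) < \<delta> \<and> dist (f s') (\<gamma> s') < \<delta>}"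
    have "open U" unfolding U_def
      by (intro open_Collect_conj open_Collect_less continuous_intros continuous_on_product_coordinates)
    moreover have "\<gamma> \<in> U" using \<open>\<delta> > 0\<close> by (simp add: U_def)
    ultimately have evU: "eventually (\<lambda>f. f \<in> U) (nhds \<gamma>)" by (rule eventually_nhds_in_open)
    show "\<exists>n\<ge>N. dist (z n s) (\<gamma> s) < \<delta> \<and> dist (z n s') (\<gamma> s') < \<delta>"
    proof (rule ccontr)
      assume "\<not> ?thesis"
      then have "\<forall>n\<ge>N. z n \<notin> U" by (auto simp: U_def)
      then have "eventually (\<lambda>f. f \<notin> U) (filtermap z sequentially)"
        unfolding eventually_filtermap eventually_sequentially by blast
      then have "eventually (\<lambda>f. False) (inf (nhds \<gamma>) (filtermap z sequentially))"
        using evU unfolding eventually_inf by blast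
      then show False using \<gamma> by (simp add: trivial_limit_def)
    qed
  qed
qed

locale coercive_weight =
  fixes K :: "'a::metric_space \<Rightarrow> real" and k :: "real \<Rightarrow> real"
  assumes proper: "proper_space TYPE('a)"
    and K0: "\<And>z. 0 \<le> K z" and K_cont: "continuous_on UNIV K"
    and zeros_fin: "finite {z. K z = 0}" and zeros_ne: "{z. K z = 0} \<noteq> {}"
    and k_cont: "continuous_on {0..} k" and k0: "\<And>t. t \<ge> 0 \<Longrightarrow> k t \<ge> 0"
    and k_inf: "(\<integral>\<^sup>+t\<in>{0..}. ennreal (k t) \<partial>lborel) = \<infinity>"
    and Kk: "\<And>z. k (infdist z {w. K w = 0}) \<le> K z"
begin

lemma compact_sublevel_infdist: "compact {v. infdist v {w. K w = 0} \<le> R}" (is "compact ?B")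
proof -
  let ?S = "{w. K w = 0}"
  obtain a e where ae: "\<And>w. w \<in> ?S \<Longrightarrow> dist a w \<le> e"
    using finite_imp_bounded[OF zeros_fin] unfolding bounded_def by auto
  have "dist a v \<le> e + (R + 1)" if "v \<in> ?B" for v
  proof -
    have "(INF w\<in>?S. dist v w) < R + 1" using that zeros_ne by (simp add: infdist_notempty)
    then obtain w where w: "w \<in> ?S" "dist v w < R + 1"
      using zeros_ne by (subst (asm) cINF_less_iff) auto
    then show ?thesis using ae[OF w(1)] dist_triangle2[of a v w] by linarith
  qed
  then have "bounded ?B" unfolding bounded_def by blast
  moreover have "closed ?B" by (intro closed_Collect_le continuous_intros)
  ultimately show ?thesis using proper unfolding proper_space_def by blast
qed

text \<open>
  Cheap chains from \<open>x\<close> live in a compact set, where \<open>K\<close> is bounded.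
\<close>

lemma chains_in_compact:
  obtains B \<epsilon> C where "\<epsilon> > 0" "compact B" "0 \<le> C" "\<And>z. z \<in> B \<Longrightarrow> K z \<le> C"
    "\<And>v c. chain K \<epsilon> x v c \<Longrightarrow> c \<le> M \<Longrightarrow> v \<in> B"
proof -
  obtain R \<epsilon> where \<epsilon>: "\<epsilon> > 0" "\<And>v c. chain K \<epsilon> x v c \<Longrightarrow> c \<le> M \<Longrightarrow> infdist v {w. K w = 0} \<le> R"
  proof (rule coercive_chain_bound[where K = K and k = k and S = "{w. K w = 0}" and x = x and M = M])
    show "0 \<le> K z" "k (infdist z {w. K w = 0}) \<le> K z" for z by (rule K0, rule Kk)
    show "0 \<le> k t" if "0 \<le> t" for t using k0 that .
  qed (rule k_cont, rule k_inf, rule that)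
  define B where "B = {v. infdist v {w. K w = 0} \<le> R}"
  have B: "compact B" unfolding B_def by (rule compact_sublevel_infdist)
  then have "bounded (K ` B)"
    by (intro compact_imp_bounded compact_continuous_image continuous_on_subset[OF K_cont]) auto
  then obtain C where "\<And>z. z \<in> B \<Longrightarrow> \<bar>K z\<bar> \<le> C" unfolding bounded_real by auto
  then have C: "K z \<le> max C 0" if "z \<in> B" for z using that by fastforce
  show thesis
    by (rule that[OF \<epsilon>(1) B _ C]) (use \<epsilon>(2) in \<open>auto simp: B_def\<close>)
qed

lemma small_reach_imp_eq:
  assumes "\<And>h. h > 0 \<Longrightarrow> reach K z v h \<or> reach K v z h"
  shows "z = v"
proof (rule ccontr)
  assume "z \<noteq> v"
  then have "dist z v > 0" by simp
  then obtain c where c: "c > 0" "\<And>v' e. dist z v \<le> dist z v' \<Longrightarrow> reach K z v' e \<or> reach K v' z e \<Longrightarrow> c \<le> e"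
    using reach_separation[OF proper K0 K_cont zeros_fin] by blast
  have "c \<le> c / 2" using c(2)[of v "c / 2"] assms[of "c / 2"] c(1) by simp
  then show False using c(1) by simp
qed

text \<open>
  The curve is a pointwise cluster point of the step functions of nearly optimal chains. The relation between two of
  its values survives by \<open>reach_limit\<close>. It equals \<open>x\<close> at negative parameters and \<open>y\<close> beyond \<open>l\<close>, which fixes the values at 0
  and \<open>l\<close> by separation of points.
\<close>

lemma reach_curve:
  assumes "reach K x y l"
  obtains \<gamma> :: "real \<Rightarrow> 'a" where "\<gamma> 0 = x" "\<gamma> l = y" "\<And>s s'. s \<le> s' \<Longrightarrow> reach K (\<gamma> s) (\<gamma> s') (s' - s)"
proof -
  obtain B \<epsilon>0 C where \<epsilon>0: "\<epsilon>0 > 0" and B: "compact B" and C: "0 \<le> C" "\<And>z. z \<in> B \<Longrightarrow> K z \<le> C"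
    and inB: "\<And>v c. chain K \<epsilon>0 x v c \<Longrightarrow> c \<le> l + 1 \<Longrightarrow> v \<in> B"
    by (rule chains_in_compact[of x "l + 1"]) (rule that)
  define e where "e n = min \<epsilon>0 (1 / real (Suc n))" for n
  have e: "0 < e n" "e n \<le> \<epsilon>0" "e n \<le> 1 / real (Suc n)" "e n \<le> 1" for n
  proof -
    have "1 / real (Suc n) \<le> 1" by (simp add: divide_le_eq)
    then show "0 < e n" "e n \<le> \<epsilon>0" "e n \<le> 1 / real (Suc n)" "e n \<le> 1"
      using \<epsilon>0 by (auto simp: e_def min_le_iff_disj)
  qed
  define P where "P n z \<longleftrightarrow> (\<forall>s<0. z s = x) \<and> (\<forall>s>l + e n. z s = y) \<and> range z \<subseteq> B \<and>
    (\<forall>s s'. s \<le> s' \<longrightarrow> (\<exists>c'. c' \<le> s' - s + C * e n \<and> chain K (e n) (z s) (z s') c'))" for n and z :: "real \<Rightarrow> 'a"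
  have "\<exists>z. P n z" for n
  proof -
    obtain c where c: "c \<le> l + e n" "chain K (e n) x y c"
      using assms e(1) unfolding reach_def by blast
    have "v \<in> B" if "chain K (e n) x v c'" "c' \<le> c" for v c'
      using inB[OF chain_mono[OF that(1) e(2)]] that(2) c(1) e(4)[of n] by linarith
    then have "\<exists>z :: real \<Rightarrow> 'a. (\<forall>s<0. z s = x) \<and> (\<forall>s>c. z s = y) \<and> range z \<subseteq> B \<and>
      (\<forall>s s'. s \<le> s' \<longrightarrow> (\<exists>c'. c' \<le> s' - s + C * e n \<and> chain K (e n) (z s) (z s') c'))"
      using e(1)[of n] K0 C by (intro chain_step_function[OF c(2)]) auto
    then obtain z :: "real \<Rightarrow> 'a" where "\<forall>s<0. z s = x" "\<forall>s>c. z s = y" "range z \<subseteq> B"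
      "\<forall>s s'. s \<le> s' \<longrightarrow> (\<exists>c'. c' \<le> s' - s + C * e n \<and> chain K (e n) (z s) (z s') c')"
      by blast
    then have "P n z" using c(1) unfolding P_def by auto
    then show ?thesis by blast
  qed
  then obtain z where z: "\<And>n. P n (z n)" by metis
  have zB: "range (z n) \<subseteq> B" for n using z[of n] unfolding P_def by blast
  obtain \<gamma> where \<gamma>: "\<And>s s' \<delta> N. \<delta> > 0 \<Longrightarrow> \<exists>n\<ge>N. dist (z n s) (\<gamma> s) < \<delta> \<and> dist (z n s') (\<gamma> s') < \<delta>"
    by (rule pointwise_cluster_function[OF B zB]) (rule that)
  have small: "\<exists>N. \<forall>n\<ge>N. e n < \<delta>" if pos: "\<delta> > 0" for \<delta>
  proof -
    obtain N where N: "1 / real (Suc N) < \<delta>" using nat_approx_posE[OF pos] by blast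
    have "e n < \<delta>" if "n \<ge> N" for n
    proof -
      have "1 / real (Suc n) \<le> 1 / real (Suc N)" using that by (intro divide_left_mono) auto
      then show ?thesis using e(3)[of n] N by linarith
    qed
    then show ?thesis by blast
  qed
  have reach: "reach K (\<gamma> s) (\<gamma> s') (s' - s)" if ss: "s \<le> s'" for s s'
  proof (rule reach_limit[OF K0 K_cont])
    fix \<delta> :: real assume "\<delta> > 0"
    then have "\<delta> / (C + 1) > 0" using C(1) by simp
    then obtain N where N: "\<And>n. n \<ge> N \<Longrightarrow> e n < \<delta> / (C + 1)" using small by blast
    obtain n where n: "n \<ge> N" "dist (z n s) (\<gamma> s) < \<delta>" "dist (z n s') (\<gamma> s') < \<delta>"
      using \<gamma>[OF \<open>\<delta> > 0\<close>] by blast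
    have "(C + 1) * e n < \<delta>" using N[OF n(1)] C(1) by (simp add: pos_less_divide_eq mult.commute)
    then have "C * e n + e n < \<delta>" by (simp add: algebra_simps)
    moreover have "0 \<le> C * e n" using C(1) e(1)[of n] by simp
    ultimately have en: "C * e n \<le> \<delta>" "e n \<le> \<delta>" using e(1)[of n] by linarith+
    obtain c' where "c' \<le> s' - s + C * e n" "chain K (e n) (z n s) (z n s') c'"
      using z[of n] ss unfolding P_def by blast
    then have "c' \<le> s' - s + \<delta>" "chain K \<delta> (z n s) (z n s') c'"
      using en(1) chain_mono[OF _ en(2)] by auto
    then show "\<exists>x' y' c'. dist (\<gamma> s) x' < \<delta> \<and> dist y' (\<gamma> s') < \<delta> \<and> c' \<le> s' - s + \<delta> \<and> chain K \<delta> x' y' c'"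
      using n by (intro exI[of _ "z n s"] exI[of _ "z n s'"] exI[of _ c']) (simp add: dist_commute)
  qed
  have neg: "\<gamma> s = x" if "s < 0" for s
  proof (rule ccontr)
    assume "\<gamma> s \<noteq> x"
    then have "dist x (\<gamma> s) > 0" by simp
    from \<gamma>[OF this, of 0 s s] show False using z that unfolding P_def by auto
  qed
  have big: "\<gamma> s = y" if sl: "s > l" for s
  proof (rule ccontr)
    assume "\<gamma> s \<noteq> y"
    then have pos: "dist y (\<gamma> s) > 0" by simp
    obtain N where N: "\<And>n. n \<ge> N \<Longrightarrow> e n < s - l" using small[of "s - l"] sl by auto
    obtain n where n: "n \<ge> N" "dist (z n s) (\<gamma> s) < dist y (\<gamma> s)" using \<gamma>[OF pos] by blast
    have "z n s = y" using N[OF n(1)] z[of n] unfolding P_def by simp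
    then show False using n(2) by simp
  qed
  show thesis
  proof (rule that[of \<gamma>])
    show "\<gamma> 0 = x"
    proof (rule sym, rule small_reach_imp_eq)
      show "reach K x (\<gamma> 0) h \<or> reach K (\<gamma> 0) x h" if "h > 0" for h
        using reach[of "- h" 0] neg[of "- h"] that by simp
    qed
    show "\<gamma> l = y"
    proof (rule small_reach_imp_eq)
      show "reach K (\<gamma> l) y h \<or> reach K y (\<gamma> l) h" if "h > 0" for h
        using reach[of l "l + h"] big[of "l + h"] that by simp
    qed
  qed (rule reach)
qed

end


section \<open>Curves between two points, and chains in length spaces\<close>

text \<open>
  For an infinite parameter interval the end point is only a limit. That some parameter to the left of any given
  one comes close to it is the common consequence of the finite and the infinite case.
\<close>

lemma curve_from_to_left_end:
  assumes "curve_from_to \<gamma> I x y" "t \<in> I" "\<delta> > 0"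
  obtains s where "s \<in> I" "s \<le> t" "dist (\<gamma> s) x < \<delta>"
proof -
  obtain a b :: ereal where ab: "I = {t. a \<le> ereal t \<and> ereal t \<le> b}" "curve_end \<gamma> a x"
    using assms(1) unfolding curve_from_to_def by blast
  show thesis
  proof (cases a)
    case (real r)
    then have "\<gamma> r = x" using ab by (simp add: curve_end_def)
    moreover have rt: "ereal r \<le> ereal t" "ereal t \<le> b" using assms(2) real unfolding ab by auto
    then have "ereal r \<le> b" by (rule order_trans)
    then have "r \<in> I" "r \<le> t" using real rt unfolding ab by auto
    ultimately show thesis using that[of r] assms(3) by simp
  next
    case PInf
    then show thesis using assms(2) unfolding ab by simp
  next
    case MInf
    then have "(\<gamma> \<longlongrightarrow> x) at_bot" using ab by (simp add: curve_end_def)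
    then have "\<forall>\<^sub>F s in at_bot. dist (\<gamma> s) x < \<delta>" using assms(3) by (rule tendstoD)
    then obtain N where N: "\<And>s. s \<le> N \<Longrightarrow> dist (\<gamma> s) x < \<delta>" unfolding eventually_at_bot_linorder by blast
    have "ereal (min N t) \<le> ereal t" "ereal t \<le> b" using assms(2) unfolding ab by auto
    then have "ereal (min N t) \<le> b" by (rule order_trans)
    then have "min N t \<in> I" using MInf unfolding ab by auto
    then show thesis using that[of "min N t"] N by simp
  qed
qed

lemma curve_from_to_right_end:
  assumes "curve_from_to \<gamma> I x y" "t \<in> I" "\<delta> > 0"
  obtains s where "s \<in> I" "t \<le> s" "dist (\<gamma> s) y < \<delta>"
proof -
  obtain a b :: ereal where ab: "I = {t. a \<le> ereal t \<and> ereal t \<le> b}" "curve_end \<gamma> b y"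
    using assms(1) unfolding curve_from_to_def by blast
  show thesis
  proof (cases b)
    case (real r)
    then have "\<gamma> r = y" using ab by (simp add: curve_end_def)
    moreover have rt: "a \<le> ereal t" "ereal t \<le> ereal r" using assms(2) real unfolding ab by auto
    then have "a \<le> ereal r" by (rule order_trans)
    then have "r \<in> I" "t \<le> r" using real rt unfolding ab by auto
    ultimately show thesis using that[of r] assms(3) by simp
  next
    case MInf
    then show thesis using assms(2) unfolding ab by simp
  next
    case PInf
    then have "(\<gamma> \<longlongrightarrow> y) at_top" using ab by (simp add: curve_end_def)
    then have "\<forall>\<^sub>F s in at_top. dist (\<gamma> s) y < \<delta>" using assms(3) by (rule tendstoD)
    then obtain N where N: "\<And>s. s \<ge> N \<Longrightarrow> dist (\<gamma> s) y < \<delta>" unfolding eventually_at_top_linorder by blast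
    have "a \<le> ereal t" "ereal t \<le> ereal (max N t)" using assms(2) unfolding ab by auto
    then have "a \<le> ereal (max N t)" by (rule order_trans)
    then have "max N t \<in> I" using PInf unfolding ab by auto
    then show thesis using that[of "max N t"] N by simp
  qed
qed

lemma curve_from_to_interval:
  assumes "curve_from_to \<gamma> I x y" "s \<in> I" "t \<in> I"
  shows "{s..t} \<subseteq> I"
proof -
  obtain a b :: ereal where ab: "I = {t. a \<le> ereal t \<and> ereal t \<le> b}"
    using assms(1) unfolding curve_from_to_def by blast
  show ?thesis
  proof
    fix r assume "r \<in> {s..t}"
    then have r: "ereal s \<le> ereal r" "ereal r \<le> ereal t" by auto
    have st: "a \<le> ereal s" "ereal t \<le> b" using assms(2,3) unfolding ab by auto
    show "r \<in> I" unfolding ab using order_trans[OF st(1) r(1)] order_trans[OF r(2) st(2)] by simp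
  qed
qed

lemma curve_length_ge_two_chords:
  assumes "s \<in> I" "\<tau> \<in> I" "t \<in> I" "s \<le> \<tau>" "\<tau> \<le> t"
  shows "ennreal (dist (\<gamma> s) (\<gamma> \<tau>) + dist (\<gamma> \<tau>) (\<gamma> t)) \<le> curve_length \<gamma> I"
proof -
  define p where "p i = (if i = 0 then s else if i = 1 then \<tau> else t)" for i :: nat
  have "(2, p) \<in> {(N, t). 1 \<le> N \<and> (\<forall>i\<le>N. t i \<in> I) \<and> (\<forall>i<N. t i \<le> t (Suc i))}"
    using assms by (auto simp: p_def)
  then have "(\<Sum>i<2. ennreal (dist (\<gamma> (p i)) (\<gamma> (p (Suc i))))) \<le> curve_length \<gamma> I"
    unfolding curve_length_def by (rule SUP_upper2) simp
  moreover have "(\<Sum>i<2::nat. ennreal (dist (\<gamma> (p i)) (\<gamma> (p (Suc i)))))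
      = ennreal (dist (\<gamma> s) (\<gamma> \<tau>) + dist (\<gamma> \<tau>) (\<gamma> t))"
    by (simp add: numeral_2_eq_2 p_def)
  ultimately show ?thesis by simp
qed

text \<open>
  On a curve that is almost as short as possible, the intermediate value theorem gives a point equidistant from
  both ends.
\<close>

lemma approximate_midpoint:
  fixes x y :: "'a::metric_space"
  assumes "length_space TYPE('a)" "\<eta> > 0"
  shows "\<exists>z. dist x z \<le> dist x y / 2 + \<eta> \<and> dist z y \<le> dist x y / 2 + \<eta>"
proof (cases "x = y")
  case True then show ?thesis using assms(2) by (intro exI[of _ x]) auto
next
  case False
  define d where "d = dist x y"
  have d: "d > 0" using False by (simp add: d_def)
  \<comment> \<open>three errors of size \<open>\<delta>\<close> occur in the sum of both distances; \<open>d / 4\<close> keeps the ends apart\<close>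
  define \<delta> where "\<delta> = min (\<eta> / 2) (d / 4)"
  have \<delta>: "\<delta> > 0" "\<delta> \<le> \<eta> / 2" "\<delta> \<le> d / 4" using assms(2) d by (auto simp: \<delta>_def)
  have "(INF (\<gamma>, I) \<in> {(\<gamma>, I). curve_from_to \<gamma> I x y}. curve_length \<gamma> I) = ennreal d"
    using assms(1) unfolding length_space_def d_def by metis
  also have "\<dots> < ennreal (d + \<delta>)" using d \<delta> by (intro ennreal_lessI) auto
  finally obtain \<gamma> I where \<gamma>: "curve_from_to \<gamma> I x y" "curve_length \<gamma> I < ennreal (d + \<delta>)"
    by (auto simp: INF_less_iff)
  have ne: "I \<noteq> {}" and cont: "continuous_on I \<gamma>" using \<gamma>(1) unfolding curve_from_to_def by auto
  then obtain t0 where "t0 \<in> I" by auto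
  obtain s where s: "s \<in> I" "s \<le> t0" "dist (\<gamma> s) x < \<delta>"
    using curve_from_to_left_end[OF \<gamma>(1) \<open>t0 \<in> I\<close> \<delta>(1)] by blast
  obtain t where t: "t \<in> I" "t0 \<le> t" "dist (\<gamma> t) y < \<delta>"
    using curve_from_to_right_end[OF \<gamma>(1) \<open>t0 \<in> I\<close> \<delta>(1)] by blast
  have st: "{s..t} \<subseteq> I" "s \<le> t" using curve_from_to_interval[OF \<gamma>(1) s(1) t(1)] s t by auto
  define h where "h r = dist x (\<gamma> r) - dist (\<gamma> r) y" for r
  have "continuous_on {s..t} h"
    unfolding h_def by (intro continuous_intros continuous_on_subset[OF cont st(1)])
  moreover have "h s \<le> 0"
    using s(3) \<delta>(3) d dist_triangle[of x y "\<gamma> s"] dist_commute[of x "\<gamma> s"] unfolding h_def d_def by linarith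
  moreover have "0 \<le> h t"
    using t(3) \<delta>(3) d dist_triangle[of x y "\<gamma> t"] unfolding h_def d_def by linarith
  ultimately obtain \<tau> where \<tau>: "s \<le> \<tau>" "\<tau> \<le> t" "h \<tau> = 0" using IVT'[of h s 0 t] st(2) by auto
  have "ennreal (dist (\<gamma> s) (\<gamma> \<tau>) + dist (\<gamma> \<tau>) (\<gamma> t)) \<le> curve_length \<gamma> I"
    using \<tau> st s t by (intro curve_length_ge_two_chords) auto
  also note \<gamma>(2)
  finally have "dist (\<gamma> s) (\<gamma> \<tau>) + dist (\<gamma> \<tau>) (\<gamma> t) < d + \<delta>"
    using d \<delta> by (subst (asm) ennreal_less_iff) auto
  moreover have "dist x (\<gamma> \<tau>) \<le> dist (\<gamma> s) x + dist (\<gamma> s) (\<gamma> \<tau>)" by (rule dist_triangle3)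
  moreover have "dist (\<gamma> \<tau>) y \<le> dist (\<gamma> \<tau>) (\<gamma> t) + dist (\<gamma> t) y" by (rule dist_triangle)
  ultimately have "dist x (\<gamma> \<tau>) + dist (\<gamma> \<tau>) y \<le> d + 3 * \<delta>" using s(3) t(3) by linarith
  then show ?thesis using \<tau>(3) \<delta>(2) assms(2) unfolding h_def d_def[symmetric] by (intro exI[of _ "\<gamma> \<tau>"]) auto
qed

text \<open>
  In a proper space the infimum over approximate midpoints is attained.
\<close>

lemma midpoint:
  fixes x y :: "'a::metric_space"
  assumes "proper_space TYPE('a)" "length_space TYPE('a)"
  shows "\<exists>z. dist x z \<le> dist x y / 2 \<and> dist z y \<le> dist x y / 2"
proof -
  define g where "g z = max (dist x z) (dist z y)" for z
  have "compact (cball x (dist x y + 1))"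
    using assms(1) unfolding proper_space_def by simp
  moreover have "continuous_on (cball x (dist x y + 1)) g" unfolding g_def by (intro continuous_intros)
  moreover have "x \<in> cball x (dist x y + 1)" by (simp add: add_nonneg_nonneg)
  ultimately obtain z where z: "\<And>w. w \<in> cball x (dist x y + 1) \<Longrightarrow> g z \<le> g w"
    using continuous_attains_inf[of "cball x (dist x y + 1)" g] by blast
  have "g z \<le> dist x y / 2"
  proof (rule field_le_epsilon)
    fix e :: real assume "e > 0"
    then have "min e 1 > 0" by simp
    then obtain w where w: "dist x w \<le> dist x y / 2 + min e 1" "dist w y \<le> dist x y / 2 + min e 1"
      using approximate_midpoint[OF assms(2), of "min e 1" x y] by blast
    have "dist x w \<le> dist x y + 1" using w(1) zero_le_dist[of x y] by linarith
    then have "g z \<le> g w" by (intro z) simp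
    also have "\<dots> \<le> dist x y / 2 + e" using w by (auto simp: g_def)
    finally show "g z \<le> dist x y / 2 + e" .
  qed
  then show ?thesis unfolding g_def by (intro exI[of _ z]) auto
qed

text \<open>
  Repeated bisection. The constant \<open>R\<close> guarantees that all points constructed stay in the ball on which \<open>K \<le> C\<close>.
\<close>

lemma length_space_chain:
  fixes K :: "'a::metric_space \<Rightarrow> real"
  assumes "proper_space TYPE('a)" "length_space TYPE('a)"
    and K: "\<And>q. dist x0 q \<le> R \<Longrightarrow> K q \<le> C" and C: "0 \<le> C"
    and "dist x y \<le> d" "d / 2 ^ n \<le> \<epsilon>" "dist x0 x + d \<le> R"
  shows "\<exists>c. c \<le> C * d \<and> chain K \<epsilon> x y c"
  using assms(5-)
proof (induction n arbitrary: x y d)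
  case 0
  have "d \<ge> 0" using 0(1) zero_le_dist[of x y] by linarith
  then have "K x \<le> C" using 0(3) by (intro K) simp
  then have "K x * dist x y \<le> C * d" using 0(1) C by (intro mult_mono) auto
  moreover have "chain K \<epsilon> x y (K x * dist x y)" using 0(1,2) by (intro chain_single) simp
  ultimately show ?case by blast
next
  case (Suc n)
  obtain z where z: "dist x z \<le> dist x y / 2" "dist z y \<le> dist x y / 2"
    using midpoint[OF assms(1,2)] by blast
  have "d \<ge> 0" using Suc.prems(1) zero_le_dist[of x y] by linarith
  moreover have "d / 2 / 2 ^ n \<le> \<epsilon>" using Suc.prems(2) by (simp add: field_simps)
  ultimately have d: "d / 2 / 2 ^ n \<le> \<epsilon>" "d \<ge> 0" by auto
  have 1: "\<exists>c. c \<le> C * (d / 2) \<and> chain K \<epsilon> x z c"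
    by (rule Suc.IH) (use z Suc.prems d in auto)
  have 2: "\<exists>c. c \<le> C * (d / 2) \<and> chain K \<epsilon> z y c"
    by (rule Suc.IH) (use z Suc.prems d dist_triangle[of x0 z x] in auto)
  obtain c1 c2 where c: "c1 \<le> C * (d / 2)" "chain K \<epsilon> x z c1" "c2 \<le> C * (d / 2)" "chain K \<epsilon> z y c2"
    using 1 2 by blast
  have "c1 + c2 \<le> C * d" using c(1,3) by simp
  then show ?case using chain_trans[OF c(4) c(2)] by blast
qed

lemma length_space_reach:
  fixes K :: "'a::metric_space \<Rightarrow> real"
  assumes "proper_space TYPE('a)" "length_space TYPE('a)" "continuous_on UNIV K"
  shows "\<exists>c. reach K x y c"
proof -
  define R where "R = dist x y"
  have "compact (cball x R)" using assms(1) unfolding proper_space_def by simp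
  then have "bounded (K ` cball x R)"
    by (intro compact_imp_bounded compact_continuous_image continuous_on_subset[OF assms(3)]) auto
  then obtain C where "\<forall>z\<in>cball x R. \<bar>K z\<bar> \<le> C" unfolding bounded_real by auto
  then have C: "\<bar>K z\<bar> \<le> C" if "dist x z \<le> R" for z using that by simp
  have C0: "0 \<le> C" using C[of x] by (simp add: R_def order_trans[OF abs_ge_zero])
  have "\<exists>c'. c' \<le> C * R + \<epsilon> \<and> chain K \<epsilon> x y c'" if "\<epsilon> > 0" for \<epsilon>
  proof -
    obtain n where n: "R / \<epsilon> < 2 ^ n" using real_arch_pow[of 2 "R / \<epsilon>"] by auto
    have "R / 2 ^ n \<le> \<epsilon>" using n that by (simp add: field_simps)
    then have "\<exists>c. c \<le> C * R \<and> chain K \<epsilon> x y c"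
      using C C0 by (intro length_space_chain[OF assms(1,2), where R = R and x0 = x and n = n]) (auto simp: R_def abs_le_iff)
    then show ?thesis using that by (metis add.commute add_increasing less_imp_le)
  qed
  then show ?thesis unfolding reach_def by blast
qed

section \<open>Admissible curves dominate the discrete distance\<close>

lemma ennreal_SUP_add_SUP_le:
  fixes f :: "'a \<Rightarrow> ennreal" and g :: "'b \<Rightarrow> ennreal"
  assumes "A \<noteq> {}" "B \<noteq> {}" and le: "\<And>a b. a \<in> A \<Longrightarrow> b \<in> B \<Longrightarrow> f a + g b \<le> c"
  shows "(SUP a\<in>A. f a) + (SUP b\<in>B. g b) \<le> c"
proof -
  have "f a + (SUP b\<in>B. g b) \<le> c" if "a \<in> A" for a
  proof -
    have "f a + (SUP b\<in>B. g b) = (SUP b\<in>B. g b) + f a" by (rule add.commute)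
    also have "\<dots> = (SUP b\<in>B. g b + f a)"
      using assms(2) by (rule ennreal_SUP_add_left[symmetric])
    also have "\<dots> \<le> c" using le[OF that] by (intro SUP_least) (simp add: add.commute)
    finally show ?thesis .
  qed
  then have "(SUP a\<in>A. f a + (SUP b\<in>B. g b)) \<le> c" by (rule SUP_least)
  then show ?thesis unfolding ennreal_SUP_add_left[OF assms(1)] .
qed

text \<open>
  Additivity over disjoint sets fails for nonmeasurable integrands, but the lower integral, as a supremum over
  simple functions, remains superadditive. This spares a proof that the metric derivative is measurable.
\<close>

lemma nn_integral_superadditive:
  assumes "A \<inter> B = {}" "A \<union> B \<subseteq> C"
  shows "(\<integral>\<^sup>+x\<in>A. f x \<partial>M) + (\<integral>\<^sup>+x\<in>B. f x \<partial>M) \<le> (\<integral>\<^sup>+x\<in>C. f x \<partial>M)"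
  unfolding nn_integral_def[of M "\<lambda>x. f x * indicator A x"] nn_integral_def[of M "\<lambda>x. f x * indicator B x"]
proof (rule ennreal_SUP_add_SUP_le)
  have "(\<lambda>_. 0) \<in> {g. simple_function M g \<and> g \<le> h}" for h :: "'a \<Rightarrow> ennreal" by (simp add: le_fun_def)
  then show "{g. simple_function M g \<and> g \<le> (\<lambda>x. f x * indicator A x)} \<noteq> {}"
    "{g. simple_function M g \<and> g \<le> (\<lambda>x. f x * indicator B x)} \<noteq> {}" by blast+
  fix g h assume "g \<in> {g. simple_function M g \<and> g \<le> (\<lambda>x. f x * indicator A x)}"
    "h \<in> {g. simple_function M g \<and> g \<le> (\<lambda>x. f x * indicator B x)}"
  then have g: "simple_function M g" "\<And>x. g x \<le> f x * indicator A x"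
    and h: "simple_function M h" "\<And>x. h x \<le> f x * indicator B x" by (auto simp: le_fun_def)
  have "integral\<^sup>S M g + integral\<^sup>S M h = (\<integral>\<^sup>+x. g x \<partial>M) + (\<integral>\<^sup>+x. h x \<partial>M)"
    using g(1) h(1) by (simp add: nn_integral_eq_simple_integral)
  also have "\<dots> = (\<integral>\<^sup>+x. g x + h x \<partial>M)"
    using g(1) h(1) by (intro nn_integral_add[symmetric] borel_measurable_simple_function)
  also have "\<dots> \<le> (\<integral>\<^sup>+x\<in>C. f x \<partial>M)"
  proof (rule nn_integral_mono)
    fix x
    have "g x + h x \<le> f x * indicator A x + f x * indicator B x" using g h by (intro add_mono)
    also have "\<dots> \<le> f x * indicator C x" using assms by (auto split: split_indicator)
    finally show "g x + h x \<le> f x * indicator C x" .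
  qed
  finally show "integral\<^sup>S M g + integral\<^sup>S M h \<le> (\<integral>\<^sup>+x\<in>C. f x \<partial>M)" .
qed

text \<open>
  The exceptional set consists of the finite points of the subdivision; a point outside of it lies in one of the
  open pieces.
\<close>

lemma piecewise_loc_lipschitz_imp_lipschitz_near:
  assumes "piecewise_loc_lipschitz \<gamma> I"
  obtains S where "finite S" "\<And>t. t \<in> I \<Longrightarrow> t \<notin> S \<Longrightarrow> lipschitz_near \<gamma> I t"
proof -
  obtain n and t :: "nat \<Rightarrow> ereal" where I: "is_interval I"
    and t0: "t 0 = (INF s\<in>I. ereal s)" and tn: "t n = (SUP s\<in>I. ereal s)"
    and inc: "\<And>i. i < n \<Longrightarrow> t i < t (Suc i)"
    and lip: "\<And>i. i < n \<Longrightarrow> locally_lipschitz_curve \<gamma> {s\<in>I. t i < ereal s \<and> ereal s < t (Suc i)}"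
    using assms unfolding piecewise_loc_lipschitz_def by blast
  have ge0: "t 0 \<le> t i" if "i \<le> n" for i
    using that
  proof (induction i)
    case (Suc i)
    then show ?case using inc[of i] by simp
  qed simp
  have len: "t i \<le> t n" if "i \<le> n" for i
    using that
  proof (induction rule: inc_induct)
    case (step m)
    then show ?case using inc[of m] by simp
  qed simp
  define S where "S = (\<lambda>i. real_of_ereal (t i)) ` {..n}"
  have "lipschitz_near \<gamma> I r" if r: "r \<in> I" "r \<notin> S" for r
  proof -
    have ne: "t i \<noteq> ereal r" if "i \<le> n" for i using r(2) that unfolding S_def by force
    have r0: "t 0 \<le> ereal r" unfolding t0 using r(1) by (rule INF_lower)
    have rn: "ereal r \<le> t n" unfolding tn using r(1) by (rule SUP_upper)
    then have rn': "ereal r < t n" using ne[of n] by auto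
    define j where "j = (LEAST j. ereal r < t j)"
    have j: "ereal r < t j" unfolding j_def using rn' by (rule LeastI)
    have "j \<le> n" unfolding j_def using rn' by (rule Least_le)
    have "j \<noteq> 0" using j r0 by (metis leD)
    then obtain i where i: "j = Suc i" by (cases j) auto
    have "\<not> ereal r < t i" using not_less_Least[of i "\<lambda>j. ereal r < t j"] i unfolding j_def by simp
    then have ti: "t i < ereal r" using ne[of i] \<open>j \<le> n\<close> i by auto
    have iN: "i < n" using i \<open>j \<le> n\<close> by simp
    define J where "J = {s. t i < ereal s \<and> ereal s < t (Suc i)}"
    have "open J" unfolding J_def by (intro open_Collect_conj open_Collect_less continuous_intros)
    have JI: "J \<subseteq> I"
    proof
      fix s assume "s \<in> J"
      then have "(INF s\<in>I. ereal s) < ereal s" "ereal s < (SUP s\<in>I. ereal s)"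
        using ge0[of i] len[of "Suc i"] iN unfolding J_def t0[symmetric] tn[symmetric] by (auto intro: le_less_trans less_le_trans)
      then obtain p q where "p \<in> I" "p < s" "q \<in> I" "s < q" by (auto simp: INF_less_iff less_SUP_iff)
      then show "s \<in> I" using I unfolding is_interval_1 by (metis less_imp_le)
    qed
    have "r \<in> J" using ti j i by (simp add: J_def)
    then obtain e where e: "e > 0" "cball r e \<subseteq> J" using \<open>open J\<close> open_contains_cball by meson
    have "{s\<in>I. t i < ereal s \<and> ereal s < t (Suc i)} = J" using JI by (auto simp: J_def)
    then have "locally_lipschitz_curve \<gamma> J" using lip[OF iN] by simp
    then obtain u L where u: "u > 0" "L-lipschitz_on (cball r u \<inter> J) \<gamma>"
      using \<open>r \<in> J\<close> unfolding locally_lipschitz_curve_def by blast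
    have sub: "{r - min u e..r + min u e} \<subseteq> cball r u \<inter> J"
      using e(2) by (force simp: cball_eq_atLeastAtMost)
    then have "L-lipschitz_on {r - min u e..r + min u e} \<gamma>" using u(2) by (rule lipschitz_on_subset[rotated])
    then show ?thesis unfolding lipschitz_near_def using u(1) e(1) sub JI
      by (intro exI[of _ "min u e"]) auto
  qed
  moreover have "finite S" by (simp add: S_def)
  ultimately show thesis using that by blast
qed

text \<open>
  Open intervals make consecutive arcs disjoint, as superadditivity requires.
\<close>

abbreviation open_weighted_length ::
  "('a::metric_space \<Rightarrow> real) \<Rightarrow> (real \<Rightarrow> 'a) \<Rightarrow> real set \<Rightarrow> real \<Rightarrow> real \<Rightarrow> ennreal" where
  "open_weighted_length K \<gamma> I a b \<equiv> (\<integral>\<^sup>+t\<in>{a<..<b}. ennreal (K (\<gamma> t) * metric_derivative \<gamma> I t) \<partial>lborel)"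

text \<open>
  Near \<open>t\<close> a single step is a good enough chain: \<open>K\<close> is almost constant along the curve, and \<open>dist (\<gamma> a) (\<gamma> b)\<close> is at most the
  integral of the metric derivative.
\<close>

lemma local_weighted_chain:
  fixes K :: "'a::metric_space \<Rightarrow> real"
  assumes K0: "\<And>z. 0 \<le> K z" and K_cont: "continuous_on UNIV K"
    and "lipschitz_near \<gamma> I t" and \<epsilon>: "\<epsilon> > 0" and \<eta>: "\<eta> > 0"
  shows "\<exists>d>0. \<forall>a b. a \<le> t \<and> t \<le> b \<and> b - a < d \<longrightarrow>
    (\<exists>c. chain K \<epsilon> (\<gamma> a) (\<gamma> b) c \<and> ennreal c \<le> open_weighted_length K \<gamma> I a b + ennreal (\<eta> * (b - a)))"
proof -
  obtain u L where u: "u > 0" and I: "{t - u..t + u} \<subseteq> I" and lip: "L-lipschitz_on {t - u..t + u} \<gamma>"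
    using assms(3) unfolding lipschitz_near_def by blast
  have L: "0 \<le> L" using lip by (rule lipschitz_on_nonneg)
  obtain m :: "real \<Rightarrow> real" where m[measurable]: "m \<in> borel_measurable borel" and m0: "\<And>t. 0 \<le> m t" and mL: "\<And>t. m t \<le> L"
    and AE_m: "AE s in lborel. s \<in> {t - u<..<t + u} \<longrightarrow> metric_derivative \<gamma> I s = m s"
    and dist_m: "\<And>v w. t - u \<le> v \<Longrightarrow> v \<le> w \<Longrightarrow> w \<le> t + u \<Longrightarrow>
       ennreal (dist (\<gamma> v) (\<gamma> w)) \<le> (\<integral>\<^sup>+s\<in>{v..w}. ennreal (m s) \<partial>lborel)"
  proof (rule local_metric_derivative[OF lip I])
    show "t - u \<le> t + u" using u by simp
  qed (rule that)
  have cont: "continuous_on {t - u..t + u} \<gamma>" using lip by (rule lipschitz_on_continuous_on)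
  have contK: "continuous_on {t - u..t + u} (\<lambda>s. K (\<gamma> s))"
    by (rule continuous_on_compose2[OF K_cont cont]) auto
  \<comment> \<open>the oscillation of \<open>K\<close> allowed along the arc; it is multiplied by the speed, which is at most \<open>L\<close>\<close>
  define \<theta> where "\<theta> = \<eta> / (L + 1)"
  have \<theta>: "\<theta> > 0" "\<theta> * L \<le> \<eta>" using \<eta> L by (auto simp: \<theta>_def field_simps)
  have t: "t \<in> {t - u..t + u}" using u by auto
  obtain d1 where d1: "d1 > 0" "\<And>s. s \<in> {t - u..t + u} \<Longrightarrow> dist s t < d1 \<Longrightarrow> dist (\<gamma> s) (\<gamma> t) < \<epsilon> / 2"
    using cont t half_gt_zero[OF \<epsilon>] unfolding continuous_on_iff by blast
  obtain d2 where d2: "d2 > 0" "\<And>s. s \<in> {t - u..t + u} \<Longrightarrow> dist s t < d2 \<Longrightarrow> dist (K (\<gamma> s)) (K (\<gamma> t)) < \<theta> / 2"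
    using contK t half_gt_zero[OF \<theta>(1)] unfolding continuous_on_iff by blast
  define d where "d = min u (min d1 d2)"
  have "\<exists>c. chain K \<epsilon> (\<gamma> a) (\<gamma> b) c \<and> ennreal c \<le> open_weighted_length K \<gamma> I a b + ennreal (\<eta> * (b - a))"
    if ab: "a \<le> t \<and> t \<le> b \<and> b - a < d" for a b
  proof -
    have abu: "{a..b} \<subseteq> {t - u..t + u}" and abd: "\<And>s. s \<in> {a..b} \<Longrightarrow> dist s t < d1 \<and> dist s t < d2"
      using ab by (auto simp: d_def dist_real_def)
    have ab_mem: "a \<in> {a..b}" "b \<in> {a..b}" using ab by auto
    have "dist (\<gamma> a) (\<gamma> t) < \<epsilon> / 2" "dist (\<gamma> b) (\<gamma> t) < \<epsilon> / 2"
      using d1(2) abu abd ab_mem by blast+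
    then have "dist (\<gamma> a) (\<gamma> b) < \<epsilon>" by (rule dist_triangle_half_l)
    then have ch: "chain K \<epsilon> (\<gamma> a) (\<gamma> b) (K (\<gamma> a) * dist (\<gamma> a) (\<gamma> b))" by (intro chain_single) simp
    have Kle: "K (\<gamma> a) \<le> K (\<gamma> s) + \<theta>" if "s \<in> {a..b}" for s
    proof -
      have "dist (K (\<gamma> a)) (K (\<gamma> t)) < \<theta> / 2" "dist (K (\<gamma> s)) (K (\<gamma> t)) < \<theta> / 2"
        using d2(2) abu abd ab_mem that by blast+
      then show ?thesis by (auto simp: dist_real_def abs_if split: if_splits)
    qed
    have "(\<lambda>s. indicator {a..b} s *\<^sub>R K (\<gamma> s)) \<in> borel_measurable borel"
      by (intro borel_measurable_continuous_on_indicator continuous_on_subset[OF contK abu]) auto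
    then have [measurable]: "(\<lambda>s. indicator {a..b} s * K (\<gamma> s)) \<in> borel_measurable borel" by simp
    have "ennreal (K (\<gamma> a) * dist (\<gamma> a) (\<gamma> b)) = ennreal (K (\<gamma> a)) * ennreal (dist (\<gamma> a) (\<gamma> b))"
      using K0 by (simp add: ennreal_mult)
    also have "\<dots> \<le> ennreal (K (\<gamma> a)) * (\<integral>\<^sup>+s\<in>{a..b}. ennreal (m s) \<partial>lborel)"
      using abu ab by (intro mult_left_mono dist_m) auto
    also have "\<dots> = (\<integral>\<^sup>+s. ennreal (K (\<gamma> a)) * (ennreal (m s) * indicator {a..b} s) \<partial>lborel)"
      by (intro nn_integral_cmult[symmetric]) measurable
    also have "\<dots> \<le> (\<integral>\<^sup>+s. ennreal (indicator {a..b} s * K (\<gamma> s) * m s) + ennreal \<eta> * indicator {a..b} s \<partial>lborel)"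
    proof (rule nn_integral_mono)
      fix s
      show "ennreal (K (\<gamma> a)) * (ennreal (m s) * indicator {a..b} s)
        \<le> ennreal (indicator {a..b} s * K (\<gamma> s) * m s) + ennreal \<eta> * indicator {a..b} s"
      proof (cases "s \<in> {a..b}")
        case True
        have "K (\<gamma> a) * m s \<le> (K (\<gamma> s) + \<theta>) * m s" using Kle[OF True] m0 by (intro mult_right_mono)
        also have "\<dots> = K (\<gamma> s) * m s + \<theta> * m s" by (simp add: distrib_right)
        also have "\<theta> * m s \<le> \<theta> * L" using \<theta>(1) mL by (intro mult_left_mono) auto
        also have "\<dots> \<le> \<eta>" by (rule \<theta>(2))
        finally have "ennreal (K (\<gamma> a) * m s) \<le> ennreal (K (\<gamma> s) * m s + \<eta>)" by (intro ennreal_leI) simp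
        then show ?thesis using True K0 m0 \<eta> by (simp add: ennreal_mult)
      qed simp
    qed
    also have "\<dots> = (\<integral>\<^sup>+s. ennreal (indicator {a..b} s * K (\<gamma> s) * m s) \<partial>lborel) + ennreal (\<eta> * (b - a))"
      using ab \<eta> by (subst nn_integral_add) (auto simp: nn_integral_cmult_indicator ennreal_mult)
    also have "(\<integral>\<^sup>+s. ennreal (indicator {a..b} s * K (\<gamma> s) * m s) \<partial>lborel) = open_weighted_length K \<gamma> I a b"
    proof (rule nn_integral_cong_AE)
      have "AE s in lborel. s \<noteq> a" "AE s in lborel. s \<noteq> b" by (rule AE_lborel_singleton)+
      then show "AE s in lborel. ennreal (indicator {a..b} s * K (\<gamma> s) * m s) =
          ennreal (K (\<gamma> s) * metric_derivative \<gamma> I s) * indicator {a<..<b} s"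
        using AE_m
      proof eventually_elim
        case (elim s)
        show ?case
        proof (cases "s \<in> {a<..<b}")
          case True
          then have "s \<in> {t - u<..<t + u}" using ab by (auto simp: d_def)
          then show ?thesis using elim(3) True by simp
        next
          case False
          then have "s \<notin> {a..b}" using elim(1,2) by auto
          then show ?thesis using False by simp
        qed
      qed
    qed
    finally show ?thesis using ch by blast
  qed
  moreover have "d > 0" using u d1 d2 by (simp add: d_def)
  ultimately show ?thesis by blast
qed

text \<open>
  Local chains are joined by the bisection principle; the error \<open>\<eta> * (b - a)\<close> is additive and so survives the joining.
\<close>

lemma weighted_chain:
  fixes K :: "'a::metric_space \<Rightarrow> real"
  assumes K0: "\<And>z. 0 \<le> K z" and K_cont: "continuous_on UNIV K"
    and near: "\<And>t. a \<le> t \<Longrightarrow> t \<le> b \<Longrightarrow> lipschitz_near \<gamma> I t" and "a \<le> b" "\<epsilon> > 0" "\<eta> > 0"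
  shows "\<exists>c. chain K \<epsilon> (\<gamma> a) (\<gamma> b) c \<and> ennreal c \<le> open_weighted_length K \<gamma> I a b + ennreal (\<eta> * (b - a))"
  using \<open>a \<le> b\<close>
proof (induction rule: Bolzano)
  case (trans a b c)
  obtain c1 where c1: "chain K \<epsilon> (\<gamma> a) (\<gamma> b) c1" "ennreal c1 \<le> open_weighted_length K \<gamma> I a b + ennreal (\<eta> * (b - a))"
    using trans(1) by blast
  obtain c2 where c2: "chain K \<epsilon> (\<gamma> b) (\<gamma> c) c2" "ennreal c2 \<le> open_weighted_length K \<gamma> I b c + ennreal (\<eta> * (c - b))"
    using trans(2) by blast
  have "ennreal (c1 + c2) = ennreal c1 + ennreal c2"
    using chain_nonneg[OF c1(1) K0] chain_nonneg[OF c2(1) K0] by simp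
  also have "\<dots> \<le> (open_weighted_length K \<gamma> I a b + ennreal (\<eta> * (b - a))) + (open_weighted_length K \<gamma> I b c + ennreal (\<eta> * (c - b)))"
    using c1(2) c2(2) by (rule add_mono)
  also have "\<dots> = (open_weighted_length K \<gamma> I a b + open_weighted_length K \<gamma> I b c) + (ennreal (\<eta> * (b - a)) + ennreal (\<eta> * (c - b)))"
    by (simp add: add_ac)
  also have "ennreal (\<eta> * (b - a)) + ennreal (\<eta> * (c - b)) = ennreal (\<eta> * (c - a))"
    using trans(3,4) \<open>\<eta> > 0\<close> by (subst ennreal_plus[symmetric]) (auto simp: algebra_simps)
  also have "open_weighted_length K \<gamma> I a b + open_weighted_length K \<gamma> I b c \<le> open_weighted_length K \<gamma> I a c"
    using trans(3,4) by (intro nn_integral_superadditive) auto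
  finally have "ennreal (c1 + c2) \<le> open_weighted_length K \<gamma> I a c + ennreal (\<eta> * (c - a))"
    by (simp add: add_right_mono)
  then show ?case using chain_trans[OF c2(1) c1(1)] by blast
next
  case (local t)
  then show ?case using local_weighted_chain[OF K0 K_cont near assms(5,6)] by blast
qed

lemma open_weighted_length_mono:
  "{a<..<b} \<subseteq> A \<Longrightarrow> open_weighted_length K \<gamma> I a b \<le> (\<integral>\<^sup>+t\<in>A. ennreal (K (\<gamma> t) * metric_derivative \<gamma> I t) \<partial>lborel)"
  by (intro nn_integral_mono) (auto split: split_indicator)

text \<open>
  The end points need not be points of local Lipschitz continuity: approach them from inside.
\<close>

lemma weighted_reach_closed_arc:
  fixes K :: "'a::metric_space \<Rightarrow> real"
  assumes K0: "\<And>z. 0 \<le> K z" and K_cont: "continuous_on UNIV K" and cont: "continuous_on {a..b} \<gamma>"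
    and near: "\<And>t. a < t \<Longrightarrow> t < b \<Longrightarrow> lipschitz_near \<gamma> I t" and "a \<le> b"
    and w: "0 \<le> w" "open_weighted_length K \<gamma> I a b \<le> ennreal w"
  shows "reach K (\<gamma> a) (\<gamma> b) w"
proof (cases "a = b")
  case True then show ?thesis using w(1) reach_refl by simp
next
  case False
  then have "a < b" using \<open>a \<le> b\<close> by simp
  show ?thesis
  proof (rule reach_limit[OF K0 K_cont])
    fix \<delta> :: real assume \<delta>: "\<delta> > 0"
    obtain d1 where d1: "d1 > 0" "\<And>s. s \<in> {a..b} \<Longrightarrow> dist s a < d1 \<Longrightarrow> dist (\<gamma> s) (\<gamma> a) < \<delta>"
      using cont \<delta> \<open>a < b\<close> unfolding continuous_on_iff by (metis atLeastAtMost_iff less_imp_le order_refl)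
    obtain d2 where d2: "d2 > 0" "\<And>s. s \<in> {a..b} \<Longrightarrow> dist s b < d2 \<Longrightarrow> dist (\<gamma> s) (\<gamma> b) < \<delta>"
      using cont \<delta> \<open>a < b\<close> unfolding continuous_on_iff by (metis atLeastAtMost_iff less_imp_le order_refl)
    define h where "h = min (min (d1 / 2) (d2 / 2)) ((b - a) / 3)"
    have h: "h > 0" "h < d1" "h < d2" using d1(1) d2(1) \<open>a < b\<close> by (auto simp: h_def)
    have "h \<le> (b - a) / 3" unfolding h_def by (rule min.cobounded2)
    then have h3: "3 * h \<le> b - a" by simp
    define a' b' where "a' = a + h" and "b' = b - h"
    have ab': "a < a'" "a' \<le> b'" "b' < b" using h h3 by (auto simp: a'_def b'_def)
    define \<eta> where "\<eta> = \<delta> / (b - a + 1)"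
    have \<eta>: "\<eta> > 0" using \<delta> \<open>a < b\<close> by (simp add: \<eta>_def)
    obtain c where c: "chain K \<delta> (\<gamma> a') (\<gamma> b') c"
        "ennreal c \<le> open_weighted_length K \<gamma> I a' b' + ennreal (\<eta> * (b' - a'))"
      using weighted_chain[OF K0 K_cont near ab'(2) \<delta> \<eta>] ab' by force
    have "\<eta> * (b' - a') \<le> \<eta> * (b - a + 1)" using \<eta> ab' by (intro mult_left_mono) auto
    also have "\<dots> = \<delta>" using \<open>a < b\<close> by (simp add: \<eta>_def)
    finally have \<eta>\<delta>: "\<eta> * (b' - a') \<le> \<delta>" .
    note c(2)
    also have "open_weighted_length K \<gamma> I a' b' + ennreal (\<eta> * (b' - a'))
        \<le> open_weighted_length K \<gamma> I a b + ennreal (\<eta> * (b' - a'))"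
      using ab' by (intro add_right_mono open_weighted_length_mono) auto
    also have "open_weighted_length K \<gamma> I a b + ennreal (\<eta> * (b' - a')) \<le> ennreal w + ennreal \<delta>"
      using w(2) \<eta>\<delta> by (intro add_mono ennreal_leI)
    also have "\<dots> = ennreal (w + \<delta>)" using w(1) \<delta> by simp
    finally have "c \<le> w + \<delta>" using w(1) \<delta> by (subst (asm) ennreal_le_iff) auto
    moreover have "dist (\<gamma> a) (\<gamma> a') < \<delta>" "dist (\<gamma> b') (\<gamma> b) < \<delta>"
      using d1(2)[of a'] d2(2)[of b'] h ab' by (auto simp: a'_def b'_def dist_real_def dist_commute)
    ultimately show "\<exists>x' y' c'. dist (\<gamma> a) x' < \<delta> \<and> dist y' (\<gamma> b) < \<delta> \<and> c' \<le> w + \<delta> \<and> chain K \<delta> x' y' c'"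
      using c(1) by blast
  qed
qed

lemma weighted_reach_split:
  fixes K :: "'a::metric_space \<Rightarrow> real"
  assumes "a \<le> b" "b \<le> c" "0 \<le> w" "open_weighted_length K \<gamma> I a c \<le> ennreal w"
    and 1: "\<And>w. 0 \<le> w \<Longrightarrow> open_weighted_length K \<gamma> I a b \<le> ennreal w \<Longrightarrow> reach K (\<gamma> a) (\<gamma> b) w"
    and 2: "\<And>w. 0 \<le> w \<Longrightarrow> open_weighted_length K \<gamma> I b c \<le> ennreal w \<Longrightarrow> reach K (\<gamma> b) (\<gamma> c) w"
  shows "reach K (\<gamma> a) (\<gamma> c) w"
proof -
  have le: "open_weighted_length K \<gamma> I a b + open_weighted_length K \<gamma> I b c \<le> ennreal w"
    using assms(1,2) by (intro order_trans[OF nn_integral_superadditive assms(4)]) auto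
  obtain w1 where w1: "0 \<le> w1" "open_weighted_length K \<gamma> I a b = ennreal w1"
    using le by (cases "open_weighted_length K \<gamma> I a b") (auto simp: top_unique)
  obtain w2 where w2: "0 \<le> w2" "open_weighted_length K \<gamma> I b c = ennreal w2"
    using le by (cases "open_weighted_length K \<gamma> I b c") (auto simp: top_unique)
  note w = w1 w2
  have "ennreal (w1 + w2) \<le> ennreal w" using le w by simp
  then have "w1 + w2 \<le> w" using assms(3) by (subst (asm) ennreal_le_iff) auto
  moreover have "reach K (\<gamma> a) (\<gamma> b) w1" "reach K (\<gamma> b) (\<gamma> c) w2" using 1[of w1] 2[of w2] w by auto
  ultimately show ?thesis using reach_trans reach_mono by blast
qed

text \<open>
  Locally there is at most one exceptional point, at which the arc is split.
\<close>

lemma weighted_reach_arc: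
  fixes K :: "'a::metric_space \<Rightarrow> real"
  assumes K0: "\<And>z. 0 \<le> K z" and K_cont: "continuous_on UNIV K" and cont: "continuous_on I \<gamma>"
    and S: "finite S" "\<And>t. t \<in> I \<Longrightarrow> t \<notin> S \<Longrightarrow> lipschitz_near \<gamma> I t" and "a \<le> b"
  shows "{a..b} \<subseteq> I \<longrightarrow> (\<forall>w. 0 \<le> w \<longrightarrow> open_weighted_length K \<gamma> I a b \<le> ennreal w \<longrightarrow> reach K (\<gamma> a) (\<gamma> b) w)"
  using \<open>a \<le> b\<close>
proof (induction rule: Bolzano)
  case (trans a b c)
  show ?case
  proof (intro impI allI)
    fix w assume I: "{a..c} \<subseteq> I" and w: "0 \<le> w" "open_weighted_length K \<gamma> I a c \<le> ennreal w"
    have "{a..b} \<subseteq> I" "{b..c} \<subseteq> I" using I trans(3,4) by auto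
    then show "reach K (\<gamma> a) (\<gamma> c) w" using trans(1,2) by (intro weighted_reach_split[OF trans(3,4) w]) auto
  qed
next
  case (local t)
  obtain d where d: "d > 0" "\<And>s. s \<in> S \<Longrightarrow> s \<noteq> t \<Longrightarrow> d \<le> dist t s"
    using finite_set_avoid[OF S(1)] by blast
  have arc: "reach K (\<gamma> p) (\<gamma> q) w" if "{p..q} \<subseteq> I" "p \<le> q" "p = t \<or> q = t" "q - p < d" "0 \<le> w"
      "open_weighted_length K \<gamma> I p q \<le> ennreal w" for p q w
  proof (rule weighted_reach_closed_arc[OF K0 K_cont continuous_on_subset[OF cont that(1)] _ that(2,5,6)])
    fix s assume s: "p < s" "s < q"
    then have "s \<notin> S" using d(2)[of s] that(3,4) by (auto simp: dist_real_def)
    moreover have "s \<in> I" using that(1) s by auto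
    ultimately show "lipschitz_near \<gamma> I s" by (intro S(2))
  qed
  show ?case
  proof (intro exI[of _ d] conjI allI impI)
    fix a b w assume ab: "a \<le> t \<and> t \<le> b \<and> b - a < d" and I: "{a..b} \<subseteq> I"
      and w: "0 \<le> w" "open_weighted_length K \<gamma> I a b \<le> ennreal w"
    have "a \<le> t" "t \<le> b" using ab by auto
    then show "reach K (\<gamma> a) (\<gamma> b) w"
      by (rule weighted_reach_split[OF _ _ w]; intro arc) (use ab I in auto)
  qed (rule d(1))
qed

lemma weighted_length_imp_reach:
  fixes K :: "'a::metric_space \<Rightarrow> real"
  assumes K0: "\<And>z. 0 \<le> K z" and K_cont: "continuous_on UNIV K"
    and \<gamma>: "piecewise_loc_lipschitz \<gamma> I" "curve_from_to \<gamma> I x y"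
    and w: "0 \<le> w" "weighted_length K \<gamma> I \<le> ennreal w"
  shows "reach K x y w"
proof (rule reach_limit[OF K0 K_cont])
  fix \<delta> :: real assume \<delta>: "\<delta> > 0"
  obtain S where S: "finite S" "\<And>t. t \<in> I \<Longrightarrow> t \<notin> S \<Longrightarrow> lipschitz_near \<gamma> I t"
    using piecewise_loc_lipschitz_imp_lipschitz_near[OF \<gamma>(1)] by blast
  have cont: "continuous_on I \<gamma>" and "I \<noteq> {}" using \<gamma>(1) unfolding piecewise_loc_lipschitz_def by auto
  then obtain t0 where "t0 \<in> I" by auto
  obtain s where s: "s \<in> I" "s \<le> t0" "dist (\<gamma> s) x < \<delta>"
    using curve_from_to_left_end[OF \<gamma>(2) \<open>t0 \<in> I\<close> \<delta>] by blast
  obtain t where t: "t \<in> I" "t0 \<le> t" "dist (\<gamma> t) y < \<delta>"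
    using curve_from_to_right_end[OF \<gamma>(2) \<open>t0 \<in> I\<close> \<delta>] by blast
  have st: "{s..t} \<subseteq> I" "s \<le> t" using curve_from_to_interval[OF \<gamma>(2) s(1) t(1)] s t by auto
  have "open_weighted_length K \<gamma> I s t \<le> weighted_length K \<gamma> I"
    unfolding weighted_length_def using st(1) by (intro open_weighted_length_mono) auto
  then have "open_weighted_length K \<gamma> I s t \<le> ennreal w" using w(2) by (rule order_trans)
  then have "reach K (\<gamma> s) (\<gamma> t) w"
    using weighted_reach_arc[OF K0 K_cont cont S st(2)] st(1) w(1) by blast
  then obtain c where "c \<le> w + \<delta>" "chain K \<delta> (\<gamma> s) (\<gamma> t) c" using \<delta> unfolding reach_def by blast
  then show "\<exists>x' y' c'. dist x x' < \<delta> \<and> dist y' y < \<delta> \<and> c' \<le> w + \<delta> \<and> chain K \<delta> x' y' c'"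
    using s(3) t(3) by (intro exI[of _ "\<gamma> s"] exI[of _ "\<gamma> t"] exI[of _ c]) (simp add: dist_commute)
qed

section \<open>A curve of minimal cost\<close>

text \<open>
  The subdivision lists the exceptional points inside \<open>(a, b)\<close> together with \<open>a\<close> and \<open>b\<close> in increasing order.
\<close>

lemma piecewise_loc_lipschitzI:
  fixes \<gamma> :: "real \<Rightarrow> 'a::metric_space"
  assumes "a \<le> b" and cont: "continuous_on {a..b} \<gamma>" and S: "finite S"
    and lip: "\<And>t. a < t \<Longrightarrow> t < b \<Longrightarrow> t \<notin> S \<Longrightarrow> lipschitz_near \<gamma> {a..b} t"
  shows "piecewise_loc_lipschitz \<gamma> {a..b}"
proof -
  have INF: "(INF s\<in>{a..b}. ereal s) = ereal a"
    by (intro antisym INF_lower INF_greatest) (use \<open>a \<le> b\<close> in auto)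
  have SUP: "(SUP s\<in>{a..b}. ereal s) = ereal b"
    by (intro antisym SUP_upper SUP_least) (use \<open>a \<le> b\<close> in auto)
  have "\<exists>(n::nat) (t::nat \<Rightarrow> ereal). t 0 = ereal a \<and> t n = ereal b \<and> (\<forall>i<n. t i < t (Suc i)) \<and>
        (\<forall>i<n. locally_lipschitz_curve \<gamma> {s\<in>{a..b}. t i < ereal s \<and> ereal s < t (Suc i)})"
  proof (cases "a = b")
    case True
    then show ?thesis by (intro exI[of _ 0] exI[of _ "\<lambda>_. ereal a"]) simp
  next
    case False
    then have "a < b" using \<open>a \<le> b\<close> by simp
    define T where "T = {a, b} \<union> (S \<inter> {a<..<b})"
    define xs where "xs = sorted_list_of_set T"
    have T: "finite T" "T \<subseteq> {a..b}" "a \<in> T" "b \<in> T" using S \<open>a < b\<close> by (auto simp: T_def)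
    have set_xs: "set xs = T" and sorted: "sorted xs" and dist_xs: "distinct xs"
      using T(1) by (auto simp: xs_def)
    have mono: "xs ! i \<le> xs ! j" if "i \<le> j" "j < length xs" for i j
      using sorted that by (rule sorted_nth_mono)
    define n where "n = length xs - 1"
    have len: "length xs = Suc n" using T(3) set_xs by (cases xs) (auto simp: n_def)
    have mem: "xs ! i \<in> {a..b}" if "i \<le> n" for i
    proof -
      have "xs ! i \<in> set xs" using that len by (intro nth_mem) simp
      then show ?thesis using T(2) set_xs by blast
    qed
    obtain ja where ja: "ja < length xs" "xs ! ja = a" using T(3) unfolding set_xs[symmetric] in_set_conv_nth by blast
    obtain jb where jb: "jb < length xs" "xs ! jb = b" using T(4) unfolding set_xs[symmetric] in_set_conv_nth by blast
    have x0: "xs ! 0 = a" using mono[of 0 ja] ja mem[of 0] by auto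
    have xn: "xs ! n = b" using mono[of jb n] jb mem[of n] len by auto
    have strict: "xs ! i < xs ! Suc i" if "i < n" for i
    proof -
      have "xs ! i \<noteq> xs ! Suc i" using dist_xs that len by (simp add: nth_eq_iff_index_eq)
      then show ?thesis using mono[of i "Suc i"] that len by simp
    qed
    have "locally_lipschitz_curve \<gamma> {s\<in>{a..b}. ereal (xs ! i) < ereal s \<and> ereal s < ereal (xs ! Suc i)}"
      (is "locally_lipschitz_curve \<gamma> ?J") if i: "i < n" for i
      unfolding locally_lipschitz_curve_def
    proof
      fix t assume "t \<in> ?J"
      then have t: "xs ! i < t" "t < xs ! Suc i" by auto
      have "t \<notin> T"
      proof
        assume "t \<in> T"
        then obtain j where j: "j < length xs" "xs ! j = t" unfolding set_xs[symmetric] in_set_conv_nth by blast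
        show False
        proof (cases "j \<le> i")
          case True then show False using mono[of j i] i len j t by simp
        next
          case False then show False using mono[of "Suc i" j] j t by simp
        qed
      qed
      moreover have "a < t" "t < b" using t mem[of i] mem[of "Suc i"] i by auto
      ultimately have "lipschitz_near \<gamma> {a..b} t" by (intro lip) (auto simp: T_def)
      then obtain u L where u: "u > 0" "L-lipschitz_on {t - u..t + u} \<gamma>" unfolding lipschitz_near_def by blast
      have "L-lipschitz_on (cball t u \<inter> ?J) \<gamma>"
        by (rule lipschitz_on_subset[OF u(2)]) (auto simp: cball_eq_atLeastAtMost)
      then show "\<exists>u>0. \<exists>L. L-lipschitz_on (cball t u \<inter> ?J) \<gamma>" using u(1) by blast
    qed
    then show ?thesis using x0 xn strict
      by (intro exI[of _ n] exI[of _ "\<lambda>i. ereal (xs ! i)"]) auto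
  qed
  then show ?thesis unfolding piecewise_loc_lipschitz_def INF SUP
    using cont \<open>a \<le> b\<close> is_interval_cc[of a b] by auto
qed

context coercive_weight
begin

lemma reach_parametrised_continuous:
  fixes \<gamma> :: "real \<Rightarrow> 'a"
  assumes reach: "\<And>s s'. s \<le> s' \<Longrightarrow> reach K (\<gamma> s) (\<gamma> s') (s' - s)"
  shows "continuous_on UNIV \<gamma>"
  unfolding continuous_on_iff
proof (intro ballI allI impI)
  fix t r :: real assume "r > 0"
  then obtain c where c: "c > 0" "\<And>v e. r \<le> dist (\<gamma> t) v \<Longrightarrow> reach K (\<gamma> t) v e \<or> reach K v (\<gamma> t) e \<Longrightarrow> c \<le> e"
    using reach_separation[OF proper K0 K_cont zeros_fin, of r "\<gamma> t"] by blast
  have "dist (\<gamma> s) (\<gamma> t) < r" if s: "dist s t < c" for s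
  proof (rule ccontr)
    assume "\<not> dist (\<gamma> s) (\<gamma> t) < r"
    then have "r \<le> dist (\<gamma> t) (\<gamma> s)" by (simp add: dist_commute)
    moreover have "reach K (\<gamma> t) (\<gamma> s) \<bar>s - t\<bar> \<or> reach K (\<gamma> s) (\<gamma> t) \<bar>s - t\<bar>"
      using reach[of s t] reach[of t s] by (cases "s \<le> t") auto
    ultimately have "c \<le> \<bar>s - t\<bar>" by (rule c(2))
    then show False using s by (simp add: dist_real_def)
  qed
  then show "\<exists>d>0. \<forall>s\<in>UNIV. dist s t < d \<longrightarrow> dist (\<gamma> s) (\<gamma> t) < r" using c(1) by blast
qed

text \<open>
  Near \<open>\<gamma> t\<close> the cost of a chain is at least \<open>\<kappa>\<close> times the distance. This gives both the local Lipschitz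
  continuity of \<open>\<gamma>\<close> and the bound \<open>1 / K (\<gamma> t)\<close> for its metric derivative.
\<close>

lemma reach_parametrised_local_bound:
  fixes \<gamma> :: "real \<Rightarrow> 'a"
  assumes reach: "\<And>s s'. s \<le> s' \<Longrightarrow> reach K (\<gamma> s) (\<gamma> s') (s' - s)" and \<kappa>: "0 \<le> \<kappa>" "\<kappa> < K (\<gamma> t)"
  shows "\<exists>d>0. \<forall>s s'. dist s t < d \<longrightarrow> dist s' t < d \<longrightarrow> \<kappa> * dist (\<gamma> s) (\<gamma> s') \<le> \<bar>s' - s\<bar>"
proof -
  obtain R where R: "R > 0" "\<And>z. dist z (\<gamma> t) < R \<Longrightarrow> dist (K z) (K (\<gamma> t)) < K (\<gamma> t) - \<kappa>"
    using K_cont \<kappa>(2) unfolding continuous_on_iff by (metis UNIV_I diff_gt_0_iff_gt)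
  have Kz: "\<kappa> \<le> K z" if "dist z (\<gamma> t) < R" for z
    using R(2)[OF that] by (auto simp: dist_real_def)
  have "R / 8 > 0" using R(1) by simp
  then obtain d where d: "d > 0" "\<And>s. dist s t < d \<Longrightarrow> dist (\<gamma> s) (\<gamma> t) < R / 8"
    using reach_parametrised_continuous[OF reach] unfolding continuous_on_iff by (metis UNIV_I)
  have le: "\<kappa> * dist (\<gamma> s) (\<gamma> s') \<le> s' - s" if s: "s \<le> s'" "dist s t < d" "dist s' t < d" for s s'
  proof -
    have near: "dist (\<gamma> s) (\<gamma> t) < R / 8" "dist (\<gamma> s') (\<gamma> t) < R / 8" using d(2) s by auto
    have "\<kappa> * min (R / 2 / 2) (dist (\<gamma> s) (\<gamma> s')) \<le> s' - s"
    proof (rule reach_local_lower_bound[OF K0 _ _ \<kappa>(1) reach[OF s(1)]])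
      fix z assume "dist (\<gamma> s) z \<le> R / 2"
      then show "\<kappa> \<le> K z"
        using near(1) dist_triangle[of z "\<gamma> t" "\<gamma> s"] R(1) by (intro Kz) (simp add: dist_commute)
    qed (use R(1) in simp)
    moreover have "dist (\<gamma> s) (\<gamma> s') \<le> R / 2 / 2"
      using near dist_triangle2[of "\<gamma> s" "\<gamma> s'" "\<gamma> t"] by simp
    ultimately show ?thesis by simp
  qed
  have "\<kappa> * dist (\<gamma> s) (\<gamma> s') \<le> \<bar>s' - s\<bar>" if "dist s t < d" "dist s' t < d" for s s'
    using le[of s s'] le[of s' s] that by (cases "s \<le> s'") (auto simp: dist_commute)
  then show ?thesis using d(1) by blast
qed

text \<open>
  Minimality makes \<open>\<gamma>\<close> injective on \<open>[0, l]\<close>, so that each of the finitely many zeros of \<open>K\<close> is met at most once.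
\<close>

lemma minimal_reach_curve:
  assumes reach_l: "reach K x y l" and minimal: "\<And>c. reach K x y c \<Longrightarrow> l \<le> c"
  obtains \<gamma> where "piecewise_loc_lipschitz \<gamma> {0..l}" "curve_from_to \<gamma> {0..l} x y"
    "weighted_length K \<gamma> {0..l} \<le> ennreal l"
proof -
  have l0: "0 \<le> l" using reach_nonneg[OF reach_l K0] .
  obtain \<gamma> :: "real \<Rightarrow> 'a" where ends: "\<gamma> 0 = x" "\<gamma> l = y"
    and reach: "\<And>s s'. s \<le> s' \<Longrightarrow> reach K (\<gamma> s) (\<gamma> s') (s' - s)"
    by (rule reach_curve[OF reach_l]) (rule that)
  have cont: "continuous_on UNIV \<gamma>" by (rule reach_parametrised_continuous[OF reach])
  \<comment> \<open>otherwise the loop between \<open>s\<close> and \<open>s'\<close> could be cut out\<close>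
  have no_return: "\<gamma> s \<noteq> \<gamma> s'" if s: "0 \<le> s" "s < s'" "s' \<le> l" for s s'
  proof
    assume eq: "\<gamma> s = \<gamma> s'"
    have "reach K x (\<gamma> s) s" using reach[of 0 s] s ends by simp
    moreover have "reach K (\<gamma> s) y (l - s')" using reach[of s' l] s ends eq by simp
    ultimately have "reach K x y (s + (l - s'))" by (rule reach_trans)
    then show False using minimal s by force
  qed
  then have "inj_on \<gamma> {0..l}" unfolding inj_on_def by (metis atLeastAtMost_iff linorder_neqE_linordered_idom)
  define Z where "Z = \<gamma> -` {z. K z = 0} \<inter> {0..l}"
  have "finite Z" unfolding Z_def by (rule finite_vimage_IntI[OF zeros_fin \<open>inj_on \<gamma> {0..l}\<close>])
  have near: "lipschitz_near \<gamma> {0..l} t" if t: "0 < t" "t < l" "t \<notin> Z" for t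
  proof -
    have "K (\<gamma> t) \<noteq> 0" using t by (auto simp: Z_def)
    then have pos: "0 < K (\<gamma> t) / 2" "K (\<gamma> t) / 2 < K (\<gamma> t)" using K0[of "\<gamma> t"] by auto
    define \<kappa> where "\<kappa> = K (\<gamma> t) / 2"
    have \<kappa>: "0 < \<kappa>" "\<kappa> < K (\<gamma> t)" using pos by (auto simp: \<kappa>_def)
    obtain d where d: "d > 0" "\<And>s s'. dist s t < d \<Longrightarrow> dist s' t < d \<Longrightarrow> \<kappa> * dist (\<gamma> s) (\<gamma> s') \<le> \<bar>s' - s\<bar>"
      using reach_parametrised_local_bound[OF reach less_imp_le[OF \<kappa>(1)] \<kappa>(2)] by blast
    define u where "u = min (d / 2) (min t (l - t))"
    have u: "u > 0" "u < d" "u \<le> t" "u \<le> l - t" using d(1) t by (auto simp: u_def)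
    have "(1 / \<kappa>)-lipschitz_on {t - u..t + u} \<gamma>"
    proof (rule lipschitz_onI)
      fix s s' assume "s \<in> {t - u..t + u}" "s' \<in> {t - u..t + u}"
      then have "\<kappa> * dist (\<gamma> s) (\<gamma> s') \<le> \<bar>s' - s\<bar>" using u(2) by (intro d(2)) (auto simp: dist_real_def)
      then show "dist (\<gamma> s) (\<gamma> s') \<le> 1 / \<kappa> * dist s s'"
        using \<kappa>(1) by (simp add: dist_real_def field_simps abs_minus_commute)
    qed (use \<kappa>(1) in simp)
    then show ?thesis unfolding lipschitz_near_def using u
      by (intro exI[of _ u]) auto
  qed
  have "weighted_length K \<gamma> {0..l} \<le> (\<integral>\<^sup>+t. indicator {0..l} t \<partial>lborel)"
    unfolding weighted_length_def
  proof (rule nn_integral_mono_AE)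
    have "AE t in lborel. t \<noteq> 0" "AE t in lborel. t \<noteq> l" by (rule AE_lborel_singleton)+
    then show "AE t in lborel. ennreal (K (\<gamma> t) * metric_derivative \<gamma> {0..l} t) * indicator {0..l} t
        \<le> indicator {0..l} t"
      using AE_metric_derivative_limit[of \<gamma> "{0..l}"]
    proof eventually_elim
      case (elim t)
      let ?m = "metric_derivative \<gamma> {0..l} t"
      have "K (\<gamma> t) * ?m \<le> 1" if t: "t \<in> {0..l}"
      proof (cases "K (\<gamma> t) = 0")
        case False
        then have Kpos: "K (\<gamma> t) > 0" using K0[of "\<gamma> t"] by simp
        have "lipschitz_near \<gamma> {0..l} t"
          using False elim(1,2) t by (intro near) (auto simp: Z_def)
        then have lim: "((\<lambda>s. dist (\<gamma> t) (\<gamma> s) / \<bar>t - s\<bar>) \<longlongrightarrow> ?m) (at t)" using elim(3) by blast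
        have le: "\<kappa> * ?m \<le> 1" if \<kappa>: "0 < \<kappa>" "\<kappa> < K (\<gamma> t)" for \<kappa>
        proof -
          obtain d where d: "d > 0" "\<And>s s'. dist s t < d \<Longrightarrow> dist s' t < d \<Longrightarrow> \<kappa> * dist (\<gamma> s) (\<gamma> s') \<le> \<bar>s' - s\<bar>"
            using reach_parametrised_local_bound[OF reach less_imp_le[OF \<kappa>(1)] \<kappa>(2)] by blast
          have "dist (\<gamma> t) (\<gamma> s) / \<bar>t - s\<bar> \<le> 1 / \<kappa>" if "s \<noteq> t" "dist s t < d" for s
          proof -
            have "\<kappa> * dist (\<gamma> t) (\<gamma> s) \<le> \<bar>t - s\<bar>" using d(2)[of t s] d(1) that by (simp add: abs_minus_commute)
            then show ?thesis using \<kappa>(1) that by (simp add: field_simps)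
          qed
          then have "\<forall>\<^sub>F s in at t. dist (\<gamma> t) (\<gamma> s) / \<bar>t - s\<bar> \<le> 1 / \<kappa>"
            using d(1) unfolding eventually_at by blast
          then have "?m \<le> 1 / \<kappa>" by (intro tendsto_upperbound[OF lim]) auto
          then show ?thesis using \<kappa>(1) by (simp add: field_simps)
        qed
        show ?thesis
        proof (rule ccontr)
          assume "\<not> K (\<gamma> t) * ?m \<le> 1"
          then have gt: "K (\<gamma> t) * ?m > 1" by simp
          then have "0 < K (\<gamma> t) * ?m" by linarith
          then have mpos: "?m > 0" using Kpos by (rule zero_less_mult_pos)
          have "1 / ?m < K (\<gamma> t)" using gt mpos by (simp add: field_simps)
          then obtain \<kappa> where \<kappa>: "1 / ?m < \<kappa>" "\<kappa> < K (\<gamma> t)" using dense by blast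
          have "0 < 1 / ?m" using mpos by simp
          then have "0 < \<kappa>" using \<kappa>(1) by linarith
          then have "\<kappa> * ?m \<le> 1" using le \<kappa>(2) by blast
          moreover have "\<kappa> * ?m > 1" using \<kappa>(1) mpos by (simp add: field_simps)
          ultimately show False by simp
        qed
      qed simp
      then show ?case by (auto split: split_indicator)
    qed
  qed
  also have "\<dots> = ennreal l" using l0 by simp
  finally have wl: "weighted_length K \<gamma> {0..l} \<le> ennreal l" .
  have pw: "piecewise_loc_lipschitz \<gamma> {0..l}"
    using l0 continuous_on_subset[OF cont] \<open>finite Z\<close> near by (intro piecewise_loc_lipschitzI) auto
  have ft: "curve_from_to \<gamma> {0..l} x y"
    unfolding curve_from_to_def curve_end_def using l0 ends continuous_on_subset[OF cont]
    by (intro exI[of _ "ereal 0"] exI[of _ "ereal l"]) auto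
  show thesis by (rule that[OF pw ft wl])
qed

end


section \<open>Existence of a minimising curve\<close>

theorem theorem2:
  fixes K :: "'a::metric_space \<Rightarrow> real"
    and k :: "real \<Rightarrow> real"
    and x y :: 'a
  assumes "proper_space TYPE('a)" and "length_space TYPE('a)"
    and "\<And>z. K z \<ge> 0"
    and "continuous_on UNIV K"
    and "finite {z. K z = 0}" and "{z. K z = 0} \<noteq> {}"
    and "continuous_on {0..} k" and "\<And>t. t \<ge> 0 \<Longrightarrow> k t \<ge> 0"
    and "(\<integral>\<^sup>+t\<in>{0..}. ennreal (k t) \<partial>lborel) = \<infinity>"
    and "\<And>z. K z \<ge> k (infdist z {w. K w = 0})"
  shows "\<exists>\<gamma> I. piecewise_loc_lipschitz \<gamma> I \<and> curve_from_to \<gamma> I x y \<and>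
           weighted_length K \<gamma> I = weighted_dist K x y"
proof -
  interpret coercive_weight K k
    by unfold_locales (fact assms)+
  define l where "l = Inf {c. reach K x y c}"
  have ne: "{c. reach K x y c} \<noteq> {}" using length_space_reach[OF assms(1,2,4)] by blast
  have bdd: "bdd_below {c. reach K x y c}" by (rule bdd_belowI[of _ 0]) (use reach_nonneg K0 in blast)
  have minimal: "l \<le> c" if "reach K x y c" for c
    unfolding l_def using that bdd by (intro cInf_lower) auto
  have reach_l: "reach K x y l"
  proof (rule reach_closed)
    fix \<delta> :: real assume "\<delta> > 0"
    then have "Inf {c. reach K x y c} < l + \<delta>" by (simp add: l_def)
    then obtain c where "reach K x y c" "c < l + \<delta>" using cInf_lessD[OF ne] by blast
    then show "reach K x y (l + \<delta>)" using reach_mono[of K x y c "l + \<delta>"] by simp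
  qed
  obtain \<gamma> where \<gamma>: "piecewise_loc_lipschitz \<gamma> {0..l}" "curve_from_to \<gamma> {0..l} x y"
    and wl: "weighted_length K \<gamma> {0..l} \<le> ennreal l"
  proof (rule minimal_reach_curve[OF reach_l])
    show "l \<le> c" if "reach K x y c" for c using minimal that .
  qed (rule that)
  have upper: "weighted_dist K x y \<le> weighted_length K \<gamma> {0..l}"
    unfolding weighted_dist_def using \<gamma> by (intro INF_lower2[of "(\<gamma>, {0..l})"]) auto
  have lower: "ennreal l \<le> weighted_dist K x y"
    unfolding weighted_dist_def
  proof (rule INF_greatest, clarify)
    fix \<gamma>' I assume \<gamma>': "piecewise_loc_lipschitz \<gamma>' I" "curve_from_to \<gamma>' I x y"
    show "ennreal l \<le> weighted_length K \<gamma>' I"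
    proof (cases "weighted_length K \<gamma>' I")
      case (real w)
      then have "reach K x y w"
        by (intro weighted_length_imp_reach[OF K0 K_cont \<gamma>']) auto
      then show ?thesis using minimal real by (simp add: ennreal_leI)
    qed simp
  qed
  have "weighted_length K \<gamma> {0..l} = weighted_dist K x y"
    using upper order_trans[OF wl lower] by (rule antisym[rotated])
  with \<gamma> show ?thesis by blast
qed

end
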